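(* If $R$ is a Mori sQQR-domain, then $R$ is a Dedekind domain.
   Context: Let $R$ be an integral domain with quotient field $K$. For a nonzero fractional ideal $I$ of $R$, put $I^{-1} = \{z \in K \mid zI \subseteq R\}$ and $I_v = (I^{-1})^{-1}$; $I$ is divisorial if $I = I_v$. $R$ is a Mori domain if it satisfies the ascending chain condition on divisorial (integral) ideals. $R$ is an sQQR-domain if each simple overring of $R$, i.e., each ring $R[u]$ with $u \in K$, is an intersection of localizations of $R$, i.e., equals $\bigcap_{P \in \mathcal P} R_P$ for some set $\mathcal P$ of prime ideals of $R$. Fields are counted as Dedekind domains. *)

theory Defs
  imports "HOL-Algebra.Finite_Extensions" "HOL-Algebra.Ring_Divisibility"
begin

(* The integral domain is given as a subset R of (the carrier of) its quotient field K;
   as a ring object it is K\<lparr>carrier := R\<rparr>. *)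
locale domain_in_quotient_field = subdomain R K + field K
  for R :: "'a set" and K :: "('a, 'b) ring_scheme" (structure) +
  assumes quotient: "x \<in> carrier K \<Longrightarrow> \<exists>a\<in>R. \<exists>b\<in>R - {\<zero>}. x = a \<otimes> inv b"
begin

definition fractional_ideal :: "'a set \<Rightarrow> bool" where
  "fractional_ideal I \<longleftrightarrow> subgroup I (add_monoid K) \<and> (\<forall>r\<in>R. \<forall>x\<in>I. r \<otimes> x \<in> I) \<and>
     (\<exists>d\<in>R - {\<zero>}. \<forall>x\<in>I. d \<otimes> x \<in> R)"

definition ideal_inverse :: "'a set \<Rightarrow> 'a set" where
  "ideal_inverse I = {z \<in> carrier K. \<forall>x\<in>I. z \<otimes> x \<in> R}"

definition v_closure :: "'a set \<Rightarrow> 'a set" where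
  "v_closure I = ideal_inverse (ideal_inverse I)"

definition divisorial :: "'a set \<Rightarrow> bool" where
  "divisorial I \<longleftrightarrow> fractional_ideal I \<and> I \<noteq> {\<zero>} \<and> I = v_closure I"

definition localization :: "'a set \<Rightarrow> 'a set" where
  "localization P = {a \<otimes> inv b | a b. a \<in> R \<and> b \<in> R - P}"

(* If the family of primes is empty, the intersection is taken to be K. This adds nothing,
   since K is the localization of R at the zero ideal. *)
definition intersection_of_localizations :: "'a set \<Rightarrow> bool" where
  "intersection_of_localizations T \<longleftrightarrow>
     (\<exists>\<P>. (\<forall>P\<in>\<P>. primeideal P (K\<lparr>carrier := R\<rparr>)) \<and>
          T = carrier K \<inter> (\<Inter>P\<in>\<P>. localization P))"

(* Polynomials are coefficient lists with the leading coefficient first. The zero polynomial []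
   has to be excluded explicitly because its lead_coeff is unspecified. *)
definition integral_over_R :: "'a \<Rightarrow> bool" where
  "integral_over_R x \<longleftrightarrow>
     (\<exists>p. polynomial R p \<and> p \<noteq> [] \<and> lead_coeff p = \<one> \<and> eval p x = \<zero>)"

end

locale mori_domain = domain_in_quotient_field +
  assumes divisorial_acc:
    "\<And>I :: nat \<Rightarrow> 'a set. \<lbrakk> \<And>n. divisorial (I n) \<and> I n \<subseteq> R; \<And>n. I n \<subseteq> I (Suc n) \<rbrakk> \<Longrightarrow>
       \<exists>N. \<forall>n\<ge>N. I n = I N"

(* simple_extension R u is the ring R[u] of values at u of polynomials over R. *)
locale sQQR_domain = domain_in_quotient_field +
  assumes simple_overring:
    "u \<in> carrier K \<Longrightarrow> intersection_of_localizations (simple_extension R u)"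

(* A Noetherian integrally closed domain of Krull dimension at most one; fields are included. *)
locale dedekind_domain = domain_in_quotient_field +
  assumes noetherian: "noetherian_ring (K\<lparr>carrier := R\<rparr>)"
    and integrally_closed: "\<lbrakk> x \<in> carrier K; integral_over_R x \<rbrakk> \<Longrightarrow> x \<in> R"
    and nonzero_prime_maximal:
      "\<lbrakk> primeideal P (K\<lparr>carrier := R\<rparr>); P \<noteq> {\<zero>} \<rbrakk> \<Longrightarrow> maximalideal P (K\<lparr>carrier := R\<rparr>)"

end

theory Submission
  imports Defs
begin

text \<open>The key step: let \<open>T \<supseteq> R\<close> be a divisorial overring and \<open>P \<subseteq> R\<close> a nonzero ideal of \<open>T\<close> with
  \<open>(T : P) = T\<close>. The Mori property bounds the zero divisors of \<open>T / zT\<close> by finitely many primes, so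
  prime avoidance gives \<open>z, y \<in> P\<close> forming a regular sequence on \<open>T\<close>. A localization of \<open>R\<close> that
  contains \<open>y / z\<close> then also contains \<open>1 / z\<close>, hence \<open>1 / z \<in> R[y / z]\<close>, and analytic independence
  of \<open>y, z\<close> forces \<open>1 \<in> P\<close>.

  With \<open>T = R[x]\<close> for a suitable \<open>x\<close>, this shows that \<open>R\<close> is completely integrally closed. For such
  \<open>R\<close>, the case \<open>T = R\<close> applies to \<open>P = I I\<inverse>\<close> for every nonzero ideal \<open>I\<close>, which makes \<open>I\<close>
  finitely generated, and to every ideal properly containing a nonzero prime.\<close>

section \<open>Prime avoidance\<close>

text \<open>Multiply one element from each \<open>Q'\<close> lying outside \<open>Q\<close>:
  primality keeps the product outside \<open>Q\<close>, and each \<open>Q'\<close> absorbs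
  it.\<close>

lemma (in cring) exists_mem_ideals_diff_primeideal:
  assumes "finite \<Q>" "\<And>Q'. Q' \<in> \<Q> \<Longrightarrow> ideal Q' R \<and> \<not> Q' \<subseteq> Q" "primeideal Q R"
  shows "\<exists>t\<in>carrier R - Q. \<forall>Q'\<in>\<Q>. t \<in> Q'"
  using assms(1,2)
proof (induction rule: finite_induct)
  case empty
  then show ?case
    using assms(3) primeideal.I_notcarr primeideal.axioms(1)
      ideal.Icarr by fastforce
next
  case (insert Q' \<Q>)
  then obtain t where t: "t \<in> carrier R" "t \<notin> Q" "\<And>Q''. Q'' \<in> \<Q> \<Longrightarrow> t \<in> Q''"
    by auto
  obtain s where s: "s \<in> Q'" "s \<notin> Q"
    using insert.prems by blast
  have s_carr: "s \<in> carrier R"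
    using s(1) insert.prems ideal.Icarr by fastforce
  have "s \<otimes> t \<notin> Q"
    using primeideal.I_prime[OF assms(3) s_carr t(1)] s t by blast
  moreover have "s \<otimes> t \<in> Q'"
    using insert.prems s(1) t(1) by (simp add: ideal.I_r_closed)
  moreover have "s \<otimes> t \<in> Q''" if "Q'' \<in> \<Q>" for Q''
    using insert.prems t(3)[OF that] s_carr that by (simp add: ideal.I_l_closed)
  ultimately show ?case
    using s_carr t(1) by (intro bexI[of _ "s \<otimes> t"]) auto
qed

lemma (in ring) mem_ideal_of_add_mem:
  assumes "ideal I R" "a \<in> carrier R" "a \<oplus> b \<in> I" "b \<in> I"
  shows "a \<in> I"
proof -
  interpret I: ideal I R by fact
  have "a = (a \<oplus> b) \<oplus> \<ominus> b"
    using assms(2,4) I.Icarr by (simp add: a_assoc r_neg)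
  then show ?thesis
    using assms(3,4) I.a_closed I.a_inv_closed by metis
qed

text \<open>Induction on the family: if the element \<open>y\<close> found so far falls into the new
  prime \<open>Q\<close>, it is corrected by a product \<open>s \<otimes> t\<close> in
  \<open>I\<close>, outside \<open>Q\<close>, where \<open>t\<close> lies in every old prime not
  contained in \<open>Q\<close>.\<close>

lemma (in cring) prime_avoidance:
  assumes I: "ideal I R" and "finite \<Q>"
    and "\<And>Q. Q \<in> \<Q> \<Longrightarrow> primeideal Q R \<and> \<not> I \<subseteq> Q"
  shows "\<exists>y\<in>I. \<forall>Q\<in>\<Q>. y \<notin> Q"
  using assms(2,3)
proof (induction rule: finite_induct)
  case empty
  then show ?case
    using additive_subgroup.zero_closed[OF ideal.axioms(1)[OF I]] by blast
next
  case (insert Q \<Q>)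
  then obtain y where y: "y \<in> I" "\<And>Q. Q \<in> \<Q> \<Longrightarrow> y \<notin> Q"
    by auto
  have Q: "primeideal Q R"
    using insert.prems by blast
  show ?case
  proof (cases "y \<in> Q")
    case False
    then show ?thesis
      using y by blast
  next
    case True
    obtain s where s: "s \<in> I" "s \<notin> Q"
      using insert.prems by blast
    have "\<exists>t\<in>carrier R - Q. \<forall>Q'\<in>{Q'\<in>\<Q>. \<not> Q' \<subseteq> Q}. t \<in> Q'"
    proof (rule exists_mem_ideals_diff_primeideal)
      show "ideal Q' R \<and> \<not> Q' \<subseteq> Q" if "Q' \<in> {Q'\<in>\<Q>. \<not> Q' \<subseteq> Q}" for Q'
        using that insert.prems primeideal.axioms(1) by blast
    qed (use insert.hyps Q in auto)
    then obtain t where t: "t \<in> carrier R" "t \<notin> Q"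
      "\<And>Q'. Q' \<in> \<Q> \<Longrightarrow> \<not> Q' \<subseteq> Q \<Longrightarrow> t \<in> Q'"
      by blast
    have carr: "s \<in> carrier R" "y \<in> carrier R"
      using ideal.Icarr[OF I] s y by auto
    have st: "s \<otimes> t \<in> I" "s \<otimes> t \<notin> Q"
      using ideal.I_r_closed[OF I s(1) t(1)] primeideal.I_prime[OF Q carr(1) t(1)] s t by auto
    have not_Q: "y \<oplus> s \<otimes> t \<notin> Q"
      using mem_ideal_of_add_mem[OF primeideal.axioms(1)[OF Q], of "s \<otimes> t" y] True st(2) carr t(1)
      by (auto simp: a_comm)
    \<comment> \<open>If \<open>Q' \<subseteq> Q\<close>, avoiding \<open>Q\<close> suffices;
      otherwise the correction lies in \<open>Q'\<close> while \<open>y\<close> does not.\<close>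
    have "y \<oplus> s \<otimes> t \<notin> Q'" if "Q' \<in> \<Q>" for Q'
    proof (cases "Q' \<subseteq> Q")
      case False
      have "ideal Q' R"
        using insert.prems that primeideal.axioms(1) by blast
      then show ?thesis
        using mem_ideal_of_add_mem[of Q' y "s \<otimes> t"] y(2)[OF that] t(3)[OF that False] carr
        by (metis ideal.I_l_closed)
    qed (use not_Q in blast)
    moreover have "y \<oplus> s \<otimes> t \<in> I"
      using additive_subgroup.a_closed[OF ideal.axioms(1)[OF I] y(1) st(1)] .
    ultimately show ?thesis
      using not_Q by blast
  qed
qed

section \<open>Ideals of a subring in terms of the ambient operations\<close>

lemma (in cring) ideal_of_subringI:
  assumes "subring T R" "I \<subseteq> T" "\<zero> \<in> I"
    and add: "\<And>a b. a \<in> I \<Longrightarrow> b \<in> I \<Longrightarrow> a \<oplus> b \<in> I"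
    and mult: "\<And>t a. t \<in> T \<Longrightarrow> a \<in> I \<Longrightarrow> t \<otimes> a \<in> I"
  shows "ideal I (R\<lparr>carrier := T\<rparr>)"
proof -
  note T = subringE[OF assms(1)]
  interpret T: ring "R\<lparr>carrier := T\<rparr>"
    using subring_is_ring[OF assms(1)] .
  have minus: "\<ominus> a \<in> I" if "a \<in> I" for a
  proof -
    have "\<ominus> a = (\<ominus> \<one>) \<otimes> a"
      using that assms(2) T(1) by (subst l_minus) auto
    then show ?thesis
      using mult[OF T(5)[OF T(3)] that] by simp
  qed
  have comm: "a \<otimes> t = t \<otimes> a" if "a \<in> I" "t \<in> T" for a t
    using that assms(2) T(1) m_comm by blast
  have "subgroup I (add_monoid R)"
    using add.subgroupI[of I] assms(2,3) T(1) add minus by auto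
  then have "subgroup I (add_monoid (R\<lparr>carrier := T\<rparr>))"
    using add.subgroup_incl[of I T] assms(1,2) by (simp add: subring_def)
  then show ?thesis
    using mult comm by (intro idealI T.ring_axioms) (simp_all, metis)
qed

lemma ideal_of_subringE:
  fixes R (structure)
  assumes "ideal I (R\<lparr>carrier := T\<rparr>)"
  shows "I \<subseteq> T" "\<zero> \<in> I" "\<And>a b. a \<in> I \<Longrightarrow> b \<in> I \<Longrightarrow> a \<oplus> b \<in> I"
    "\<And>t a. t \<in> T \<Longrightarrow> a \<in> I \<Longrightarrow> t \<otimes> a \<in> I"
proof -
  interpret ideal I "R\<lparr>carrier := T\<rparr>" by fact
  show "I \<subseteq> T" "\<zero> \<in> I" "\<And>a b. a \<in> I \<Longrightarrow> b \<in> I \<Longrightarrow> a \<oplus> b \<in> I"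
    "\<And>t a. t \<in> T \<Longrightarrow> a \<in> I \<Longrightarrow> t \<otimes> a \<in> I"
    using a_subset additive_subgroup.zero_closed[OF additive_subgroup_axioms]
      additive_subgroup.a_closed[OF additive_subgroup_axioms] I_l_closed
    by simp_all
qed

lemma (in ring) ideal_of_subringE_minus:
  assumes "subring T R" "ideal I (R\<lparr>carrier := T\<rparr>)" "a \<in> I"
  shows "\<ominus> a \<in> I"
proof -
  have "\<ominus> a = (\<ominus> \<one>) \<otimes> a"
    using assms subringE(1)[OF assms(1)] ideal_of_subringE(1)[OF assms(2)]
    by (subst l_minus) auto
  then show ?thesis
    using ideal_of_subringE(4)[OF assms(2) subringE(5)[OF assms(1)] assms(3)] subringE(3)[OF assms(1)]
    by metis
qed

section \<open>Arithmetic in the quotient field, prime ideals and localizations\<close>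

context domain_in_quotient_field
begin

lemma R_subring: "subring R K"
  using subring_axioms .

lemma R_closed: "a \<in> R \<Longrightarrow> a \<in> carrier K"
  using subringE(1)[OF R_subring] by blast

lemmas R_mult = subringE(6)[OF R_subring]
  and R_add = subringE(7)[OF R_subring]
  and R_minus = subringE(5)[OF R_subring]
  and R_zero = subringE(2)[OF R_subring]
  and R_one = subringE(3)[OF R_subring]

lemma R_pow: "a \<in> R \<Longrightarrow> a [^] (n :: nat) \<in> R"
  by (induction n) (auto simp: R_one R_mult)

lemma R_cring: "cring (K\<lparr>carrier := R\<rparr>)"
  using subcring_iff[OF subringE(1)[OF R_subring]] subcring_axioms by blast

lemma inv_nonzero:
  assumes "z \<in> carrier K" "z \<noteq> \<zero>"
  shows "inv z \<in> carrier K" "inv z \<noteq> \<zero>" "z \<otimes> inv z = \<one>" "inv z \<otimes> z = \<one>"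
proof -
  have z: "z \<in> Units K"
    using assms field_Units by blast
  then show "inv z \<in> carrier K" "z \<otimes> inv z = \<one>" "inv z \<otimes> z = \<one>"
    by auto
  then show "inv z \<noteq> \<zero>"
    using assms(1) one_not_zero by auto
qed

lemma primeideal_of_RE:
  assumes "primeideal P (K\<lparr>carrier := R\<rparr>)"
  shows "ideal P (K\<lparr>carrier := R\<rparr>)" "P \<subseteq> R" "\<one> \<notin> P"
    "\<And>a b. a \<in> R \<Longrightarrow> b \<in> R \<Longrightarrow> a \<otimes> b \<in> P \<Longrightarrow> a \<in> P \<or> b \<in> P"
proof -
  interpret P: primeideal P "K\<lparr>carrier := R\<rparr>" by fact
  show "ideal P (K\<lparr>carrier := R\<rparr>)" "P \<subseteq> R"
    "\<And>a b. a \<in> R \<Longrightarrow> b \<in> R \<Longrightarrow> a \<otimes> b \<in> P \<Longrightarrow> a \<in> P \<or> b \<in> P"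
    using P.is_ideal P.a_subset P.I_prime by auto
  show "\<one> \<notin> P"
    using P.one_imp_carrier P.I_notcarr by auto
qed

lemma primeideal_of_RI:
  assumes "ideal P (K\<lparr>carrier := R\<rparr>)" "\<one> \<notin> P"
    and "\<And>a b. a \<in> R \<Longrightarrow> b \<in> R \<Longrightarrow> a \<otimes> b \<in> P \<Longrightarrow> b \<notin> P \<Longrightarrow> a \<in> P"
  shows "primeideal P (K\<lparr>carrier := R\<rparr>)"
proof (rule primeidealI[OF assms(1) R_cring])
  show "carrier (K\<lparr>carrier := R\<rparr>) \<noteq> P"
    using assms(2) R_one by auto
  show "a \<in> P \<or> b \<in> P"
    if "a \<in> carrier (K\<lparr>carrier := R\<rparr>)" "b \<in> carrier (K\<lparr>carrier := R\<rparr>)"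
      "a \<otimes>\<^bsub>K\<lparr>carrier := R\<rparr>\<^esub> b \<in> P" for a b
    using assms(3)[of a b] that by auto
qed

text \<open>With \<open>localizationE\<close> as converse for primes, membership in
  \<open>localization P\<close> becomes the existence of a nonzero denominator outside
  \<open>P\<close>.\<close>

lemma fraction_in_localization:
  assumes "x \<in> carrier K" "b \<in> R - P" "b \<noteq> \<zero>" "x \<otimes> b \<in> R"
  shows "x \<in> localization P"
proof -
  have b: "b \<in> carrier K"
    using assms R_closed by blast
  note inv = inv_nonzero[OF b assms(3)]
  have "x = (x \<otimes> b) \<otimes> inv b"
    using assms(1) b inv by (simp add: m_assoc)
  then show ?thesis
    using assms unfolding localization_def by blast
qed

lemma localizationE:
  assumes "x \<in> localization P" "primeideal P (K\<lparr>carrier := R\<rparr>)"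
  obtains b where "b \<in> R - P" "b \<noteq> \<zero>" "x \<otimes> b \<in> R"
proof -
  obtain a b where ab: "a \<in> R" "b \<in> R - P" "x = a \<otimes> inv b"
    using assms(1) unfolding localization_def by blast
  have nz: "b \<noteq> \<zero>"
    using ab ideal_of_subringE(2)[OF primeideal_of_RE(1)[OF assms(2)]] by auto
  have b: "b \<in> carrier K"
    using ab R_closed by blast
  have "x \<otimes> b = a"
    using ab R_closed inv_nonzero[OF b nz] b by (simp add: m_assoc)
  then show thesis
    using that ab nz by blast
qed

lemma exists_denominator:
  assumes "x \<in> carrier K"
  obtains d where "d \<in> R" "d \<noteq> \<zero>" "x \<otimes> d \<in> R"
proof -
  obtain a b where ab: "a \<in> R" "b \<in> R" "b \<noteq> \<zero>" "x = a \<otimes> inv b"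
    using quotient[OF assms] by blast
  then have "x \<otimes> b = a"
    using inv_nonzero[of b] by (simp add: m_assoc R_closed)
  then show thesis
    using that ab by blast
qed

section \<open>Almost integral elements\<close>

text \<open>Membership in the complete integral closure of \<open>R\<close>: one nonzero
  \<open>c\<close> is a common denominator of all powers of \<open>x\<close>.\<close>

definition almost_integral :: "'a \<Rightarrow> bool" where
  "almost_integral x \<longleftrightarrow>
     x \<in> carrier K \<and> (\<exists>c\<in>R. c \<noteq> \<zero> \<and> (\<forall>k::nat. c \<otimes> x [^] k \<in> R))"

lemma almost_integral_mult:
  assumes "almost_integral x" "b \<in> R"
  shows "almost_integral (b \<otimes> x)"
proof -
  obtain c where c: "c \<in> R" "c \<noteq> \<zero>" "\<And>k::nat. c \<otimes> x [^] k \<in> R" and x: "x \<in> carrier K"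
    using assms(1) unfolding almost_integral_def by blast
  have "c \<otimes> (b \<otimes> x) [^] k \<in> R" for k :: nat
  proof -
    have "c \<otimes> (b \<otimes> x) [^] k = b [^] k \<otimes> (c \<otimes> x [^] k)"
      using c(1) assms(2) x R_closed by (subst nat_pow_distrib) (auto simp: m_ac)
    then show ?thesis
      using R_mult[OF R_pow[OF assms(2)] c(3)] by simp
  qed
  then show ?thesis
    using c x assms(2) R_closed unfolding almost_integral_def by blast
qed

text \<open>Starting from \<open>c\<close>, every multiplication by \<open>x\<close> stays in
  \<open>M\<close>, so \<open>c\<close> is a common denominator of the powers of
  \<open>x\<close>.\<close>

lemma almost_integralI_invariant:
  assumes "x \<in> carrier K" "c \<in> M" "c \<noteq> \<zero>" "M \<subseteq> R"
    and invariant: "\<And>a. a \<in> M \<Longrightarrow> x \<otimes> a \<in> M"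
  shows "almost_integral x"
proof -
  have c: "c \<in> R" "c \<in> carrier K"
    using assms R_closed by auto
  have "c \<otimes> x [^] k \<in> M" for k :: nat
  proof (induction k)
    case 0
    then show ?case
      using c assms(2) by simp
  next
    case (Suc k)
    have "c \<otimes> x [^] Suc k = x \<otimes> (c \<otimes> x [^] k)"
      using c assms(1) by (simp add: m_ac)
    then show ?case
      using invariant[OF Suc] by simp
  qed
  then show ?thesis
    using assms(1,3,4) c unfolding almost_integral_def by blast
qed

lemma eval_denominator:
  assumes "set q \<subseteq> R" "x \<in> carrier K" "c \<in> carrier K"
    and "\<And>i. i < length q \<Longrightarrow> c \<otimes> x [^] i \<in> R"
  shows "c \<otimes> eval q x \<in> R"
  using assms(1,4)
proof (induction q)
  case Nil
  then show ?case
    using assms(3) R_zero by simp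
next
  case (Cons a q)
  have a: "a \<in> R" "set q \<subseteq> R"
    using Cons.prems(1) by auto
  have carr: "a \<in> carrier K" "eval q x \<in> carrier K"
    using a R_closed assms(2) by (auto intro!: eval_in_carrier)
  have "c \<otimes> eval (a # q) x = a \<otimes> (c \<otimes> x [^] length q) \<oplus> c \<otimes> eval q x"
    using carr assms(2,3) by (simp add: r_distr m_ac)
  moreover have "c \<otimes> eval q x \<in> R"
    using Cons.IH a Cons.prems(2) by simp
  moreover have "a \<otimes> (c \<otimes> x [^] length q) \<in> R"
    using R_mult[OF a(1) Cons.prems(2)[of "length q"]] by simp
  ultimately show ?case
    using R_add by simp
qed

text \<open>If \<open>d\<close> is a denominator of \<open>x\<close> and \<open>n\<close> the degree
  of a monic equation, then \<open>d [^] n\<close> is a denominator of all powers: directly up to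
  exponent \<open>n\<close>, and beyond it by means of the equation.\<close>

lemma integral_imp_almost_integral:
  assumes x: "x \<in> carrier K" and "integral_over_R x"
  shows "almost_integral x"
proof -
  obtain p where p: "polynomial R p" "p \<noteq> []" "lead_coeff p = \<one>" "eval p x = \<zero>"
    using assms(2) unfolding integral_over_R_def by blast
  then obtain q where q: "p = \<one> # q" "set q \<subseteq> R"
    by (cases p) (auto simp: polynomial_def)
  define n where "n = length q"
  have eval_carr: "eval q x \<in> carrier K"
    using q(2) R_closed x by (auto intro!: eval_in_carrier)
  have "x [^] n \<oplus> eval q x = \<zero>"
    using p(4) x unfolding q(1) n_def by simp
  then have top: "x [^] n = \<ominus> eval q x"
    using eval_carr x by (simp add: minus_equality)
  obtain d where d: "d \<in> R" "d \<noteq> \<zero>" "x \<otimes> d \<in> R"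
    using exists_denominator[OF x] by blast
  have d_carr: "d \<in> carrier K"
    using d R_closed by blast
  have "d [^] n \<otimes> x [^] k \<in> R" for k :: nat
  proof (induction k rule: less_induct)
    case (less k)
    show ?case
    proof (cases "k \<le> n")
      case True
      then have "d [^] n = d [^] (n - k) \<otimes> d [^] k"
        using d_carr by (simp add: nat_pow_mult)
      then have "d [^] n \<otimes> x [^] k = d [^] (n - k) \<otimes> (x \<otimes> d) [^] k"
        using d_carr x by (simp add: nat_pow_distrib m_ac)
      then show ?thesis
        using d R_mult R_pow by simp
    next
      case False
      \<comment> \<open>Multiplied by \<open>x [^] j\<close>, the equation expresses
        \<open>x [^] k\<close> by powers with exponents \<open>j + i < k\<close>, which the
        induction hypothesis covers.\<close>
      define j where "j = k - n"
      have k: "k = n + j"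
        using False j_def by simp
      have "(d [^] n \<otimes> x [^] j) \<otimes> eval q x \<in> R"
      proof (rule eval_denominator)
        fix i assume "i < length q"
        then have "d [^] n \<otimes> x [^] (j + i) \<in> R"
          using k n_def by (intro less) simp
        then show "(d [^] n \<otimes> x [^] j) \<otimes> x [^] i \<in> R"
          using d_carr x by (simp add: m_assoc nat_pow_mult)
      qed (use q(2) x d_carr in auto)
      moreover have "d [^] n \<otimes> x [^] k = \<ominus> ((d [^] n \<otimes> x [^] j) \<otimes> eval q x)"
      proof -
        have "x [^] k = x [^] j \<otimes> x [^] n"
          unfolding k using x by (simp add: nat_pow_mult add.commute)
        then show ?thesis
          unfolding top using eval_carr x d_carr by (simp add: r_minus m_assoc)
      qed
      ultimately show ?thesis
        using R_minus by simp
    qed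
  qed
  moreover have "d [^] n \<noteq> \<zero>"
    using d(2) d_carr by (induction n) (auto simp: integral_iff)
  ultimately show ?thesis
    using x R_pow[OF d(1)] unfolding almost_integral_def by blast
qed

section \<open>Inverses and divisorial ideals\<close>

lemma ideal_inverse_carrier: "ideal_inverse A \<subseteq> carrier K"
  unfolding ideal_inverse_def by blast

lemma ideal_inverse_antimono: "A \<subseteq> B \<Longrightarrow> ideal_inverse B \<subseteq> ideal_inverse A"
  unfolding ideal_inverse_def by blast

text \<open>Taking inverses is an order-reversing Galois connection, so three inverses equal
  one.\<close>

lemma v_closure_ideal_inverse:
  assumes "A \<subseteq> carrier K"
  shows "v_closure (ideal_inverse A) = ideal_inverse A"
proof -
  have "A \<subseteq> v_closure A"
    using assms m_comm unfolding v_closure_def ideal_inverse_def by fastforce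
  then have "ideal_inverse (v_closure A) \<subseteq> ideal_inverse A"
    by (rule ideal_inverse_antimono)
  moreover have "ideal_inverse A \<subseteq> v_closure (ideal_inverse A)"
    using m_comm unfolding v_closure_def ideal_inverse_def by fastforce
  ultimately show ?thesis
    unfolding v_closure_def by blast
qed

lemma ideal_inverse_add:
  assumes "A \<subseteq> carrier K" "a \<in> ideal_inverse A" "b \<in> ideal_inverse A"
  shows "a \<oplus> b \<in> ideal_inverse A"
  using assms R_add unfolding ideal_inverse_def by (auto simp: l_distr subset_iff)

lemma ideal_inverse_mult:
  assumes "A \<subseteq> carrier K" "r \<in> R" "a \<in> ideal_inverse A"
  shows "r \<otimes> a \<in> ideal_inverse A"
  using assms R_mult unfolding ideal_inverse_def by (auto simp: R_closed m_assoc subset_iff)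

definition "integral_divisorials = {I. divisorial I \<and> I \<subseteq> R}"

lemma integral_divisorialsD:
  assumes "I \<in> integral_divisorials"
  shows "divisorial I" "I \<subseteq> R" "v_closure I = I"
  using assms unfolding integral_divisorials_def divisorial_def by (blast, blast, metis (lifting) mem_Collect_eq)

lemma ideal_inverse_integral_ideal:
  assumes "A \<subseteq> carrier K" "\<one> \<in> A"
  shows "ideal_inverse A \<subseteq> R" "ideal (ideal_inverse A) (K\<lparr>carrier := R\<rparr>)"
proof -
  show *: "ideal_inverse A \<subseteq> R"
    using assms unfolding ideal_inverse_def by fastforce
  have "\<zero> \<in> ideal_inverse A"
    using assms R_zero unfolding ideal_inverse_def by (auto simp: subset_iff)
  then show "ideal (ideal_inverse A) (K\<lparr>carrier := R\<rparr>)"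
    using ideal_inverse_add ideal_inverse_mult assms *
    by (intro ideal_of_subringI[OF R_subring]) auto
qed

text \<open>Source of the divisorial ideals used later: \<open>\<one> \<in> A\<close> forces the
  inverse into \<open>R\<close>, being an inverse makes it v-closed, and \<open>z\<close> makes it
  nonzero.\<close>

lemma ideal_inverse_integral_divisorial:
  assumes "A \<subseteq> carrier K" "\<one> \<in> A" "z \<in> ideal_inverse A" "z \<noteq> \<zero>"
  shows "ideal_inverse A \<in> integral_divisorials"
proof -
  interpret I: ideal "ideal_inverse A" "K\<lparr>carrier := R\<rparr>"
    using ideal_inverse_integral_ideal[OF assms(1,2)] by blast
  have "subgroup (ideal_inverse A) (add_monoid (K\<lparr>carrier := R\<rparr>))"
    using I.a_subgroup .
  then have "subgroup (ideal_inverse A) (add_monoid K)"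
    using add.incl_subgroup[of R "ideal_inverse A"] R_subring by (simp add: subring_def)
  moreover have "\<exists>d\<in>R - {\<zero>}. \<forall>x\<in>ideal_inverse A. d \<otimes> x \<in> R"
    using ideal_inverse_integral_ideal(1)[OF assms(1,2)] R_one R_mult one_not_zero
    by (intro bexI[of _ "\<one>"]) auto
  ultimately have "fractional_ideal (ideal_inverse A)"
    using ideal_inverse_mult[OF assms(1)] unfolding fractional_ideal_def by blast
  then show ?thesis
    using v_closure_ideal_inverse[OF assms(1)] assms(3,4)
      ideal_inverse_integral_ideal(1)[OF assms(1,2)]
    unfolding integral_divisorials_def divisorial_def by auto
qed

end


section \<open>Chain conditions on divisorial ideals of a Mori domain\<close>

context mori_domain
begin

text \<open>The larger ideal counts as the predecessor, so the ascending chain condition becomes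
  well-foundedness, and minimal elements of the relation are maximal ideals of the family.\<close>

lemma wf_integral_divisorials_superset:
  "wf {(I, J). I \<in> integral_divisorials \<and> J \<in> integral_divisorials \<and> J \<subset> I}"
proof -
  have no_chain: False if I: "\<And>n. I n \<in> integral_divisorials \<and> I (Suc n) \<in> integral_divisorials
      \<and> I n \<subset> I (Suc n)" for I :: "nat \<Rightarrow> 'a set"
  proof -
    have "\<exists>N. \<forall>n\<ge>N. I n = I N"
      by (intro divisorial_acc conjI; use I in \<open>blast dest: integral_divisorialsD\<close>)
    then obtain N where "\<forall>n\<ge>N. I n = I N"
      by blast
    then have "I (Suc N) = I N"
      by (metis le_SucI order_refl)
    then show False
      using I[of N] by blast
  qed
  show ?thesis
    unfolding wf_iff_no_infinite_down_chain
  proof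
    assume "\<exists>f. \<forall>n. (f (Suc n), f n) \<in>
      {(I, J). I \<in> integral_divisorials \<and> J \<in> integral_divisorials \<and> J \<subset> I}"
    then obtain f where f: "\<And>n. (f (Suc n), f n) \<in>
      {(I, J). I \<in> integral_divisorials \<and> J \<in> integral_divisorials \<and> J \<subset> I}"
      by blast
    show False
      using f by (intro no_chain[of f]) simp
  qed
qed

lemma exists_maximal_divisorial:
  assumes "\<F> \<subseteq> integral_divisorials" "I \<in> \<F>"
  obtains M where "M \<in> \<F>" "I \<subseteq> M" "\<And>J. J \<in> \<F> \<Longrightarrow> M \<subseteq> J \<Longrightarrow> J = M"
proof -
  have "I \<in> {M \<in> \<F>. I \<subseteq> M}"
    using assms by blast
  then obtain M where M: "M \<in> \<F>" "I \<subseteq> M"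
    and min: "\<And>J. (J, M) \<in> {(I, J). I \<in> integral_divisorials \<and> J \<in> integral_divisorials \<and> J \<subset> I}
      \<Longrightarrow> J \<notin> {M \<in> \<F>. I \<subseteq> M}"
    by (rule wfE_min[OF wf_integral_divisorials_superset]) blast
  have "J = M" if J: "J \<in> \<F>" "M \<subseteq> J" for J
    using min[of J] J M assms(1) by blast
  then show thesis
    using that M by blast
qed

text \<open>Duality \<open>I \<mapsto> z I\<inverse>\<close> turns the ascending chain condition into a descending one.\<close>

lemma exists_minimal_divisorial:
  assumes "\<F> \<subseteq> integral_divisorials" "I \<in> \<F>" "z \<in> carrier K" "z \<noteq> \<zero>"
    and z: "\<And>J. J \<in> \<F> \<Longrightarrow> z \<in> J"
  obtains M where "M \<in> \<F>" "\<And>J. J \<in> \<F> \<Longrightarrow> J \<subseteq> M \<Longrightarrow> J = M"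
proof -
  note inv_z = inv_nonzero[OF assms(3,4)]
  \<comment> \<open>This is \<open>z\<close> times the inverse of \<open>J\<close>. It is integral
    because \<open>z \<in> J\<close>, and contains \<open>z\<close> because
    \<open>J \<subseteq> R\<close>.\<close>
  define dual where "dual J = ideal_inverse ((\<lambda>x. inv z \<otimes> x) ` J)" for J
  have sub: "J \<subseteq> R" "v_closure J = J" if "J \<in> \<F>" for J
    using assms(1) that integral_divisorialsD by blast+
  have dual_divisorial: "dual J \<in> integral_divisorials" if J: "J \<in> \<F>" for J
    unfolding dual_def
  proof (rule ideal_inverse_integral_divisorial)
    have J_carr: "J \<subseteq> carrier K"
      using sub(1)[OF J] R_closed by blast
    then show "(\<lambda>x. inv z \<otimes> x) ` J \<subseteq> carrier K"
      using inv_z by auto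
    show "\<one> \<in> (\<lambda>x. inv z \<otimes> x) ` J"
      using z[OF J] inv_z by (metis image_eqI)
    have "z \<otimes> (inv z \<otimes> x) \<in> R" if "x \<in> J" for x
    proof -
      have "z \<otimes> (inv z \<otimes> x) = x"
        using that J_carr inv_z assms(3) by (auto simp: m_assoc[symmetric])
      then show ?thesis
        using that sub(1)[OF J] by auto
    qed
    then show "z \<in> ideal_inverse ((\<lambda>x. inv z \<otimes> x) ` J)"
      using assms(3) unfolding ideal_inverse_def by auto
  qed (fact assms(4))
  have dual_antimono: "dual J' \<subseteq> dual J" if "J \<subseteq> J'" for J J'
    unfolding dual_def using that by (intro ideal_inverse_antimono) blast
  \<comment> \<open>Cancelling \<open>z\<close> shows that equal duals have equal inverses; by
    divisoriality the ideals then agree.\<close>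
  have inverse_subset: "ideal_inverse J' \<subseteq> ideal_inverse J"
    if "J \<in> \<F>" "J' \<in> \<F>" "dual J' \<subseteq> dual J" for J J'
  proof
    fix w assume w: "w \<in> ideal_inverse J'"
    then have w_carr: "w \<in> carrier K"
      using ideal_inverse_carrier by blast
    have eq: "(z \<otimes> w) \<otimes> (inv z \<otimes> x) = w \<otimes> x" if "x \<in> carrier K" for x
    proof -
      have "(z \<otimes> w) \<otimes> (inv z \<otimes> x) = (z \<otimes> inv z) \<otimes> (w \<otimes> x)"
        using that w_carr assms(3) inv_z(1) by (simp add: m_ac)
      then show ?thesis
        using that w_carr inv_z by simp
    qed
    have carr: "J \<subseteq> carrier K" "J' \<subseteq> carrier K"
      using sub(1) that R_closed by blast+
    have "z \<otimes> w \<in> dual J'"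
      using w eq carr(2) w_carr assms(3) unfolding dual_def ideal_inverse_def by auto
    then have "z \<otimes> w \<in> dual J"
      using that by blast
    then show "w \<in> ideal_inverse J"
      using eq carr(1) w_carr unfolding dual_def ideal_inverse_def by force
  qed
  have "dual ` \<F> \<subseteq> integral_divisorials" "dual I \<in> dual ` \<F>"
    using dual_divisorial assms(2) by auto
  then obtain D where D: "D \<in> dual ` \<F>" "\<And>E. E \<in> dual ` \<F> \<Longrightarrow> D \<subseteq> E \<Longrightarrow> E = D"
    using exists_maximal_divisorial by metis
  obtain M where M: "M \<in> \<F>" "D = dual M"
    using D(1) by blast
  have "J = M" if J: "J \<in> \<F>" "J \<subseteq> M" for J
  proof -
    have "dual J = dual M"
      using D(2) M dual_antimono J by simp
    then have "ideal_inverse J = ideal_inverse M"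
      using inverse_subset J(1) M(1) by blast
    then show ?thesis
      using sub(2) J(1) M(1) unfolding v_closure_def by metis
  qed
  then show thesis
    using that M(1) by blast
qed

text \<open>Among the finite intersections of members of \<open>\<F>\<close>, all divisorial and
  containing \<open>z\<close>, there is a minimal one. Every \<open>Q \<in> \<F>\<close> contains
  it, so the prime \<open>Q\<close> contains one of the finitely many members intersected, and
  equals it by incomparability.\<close>

lemma finite_maximal_divisorials:
  assumes \<F>: "\<F> \<subseteq> integral_divisorials" "z \<in> carrier K" "z \<noteq> \<zero>"
    and z: "\<And>I. I \<in> \<F> \<Longrightarrow> z \<in> I"
    and prime: "\<And>Q. Q \<in> \<F> \<Longrightarrow> primeideal Q (K\<lparr>carrier := R\<rparr>)"
    and maximal: "\<And>Q Q'. Q \<in> \<F> \<Longrightarrow> Q' \<in> \<F> \<Longrightarrow> Q \<subseteq> Q' \<Longrightarrow> Q = Q'"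
  shows "finite \<F>"
proof (cases "\<F> = {}")
  case False
  define \<G> where "\<G> = {\<Inter>\<A> | \<A>. \<A> \<subseteq> \<F> \<and> finite \<A> \<and> \<A> \<noteq> {}}"
  \<comment> \<open>An intersection of inverses is the inverse of the union, hence divisorial;
    \<open>z\<close> keeps it nonzero.\<close>
  have "\<Inter>\<A> \<in> integral_divisorials" if \<A>: "\<A> \<subseteq> \<F>" "\<A> \<noteq> {}" for \<A>
  proof -
    have dv: "v_closure I = I" "I \<subseteq> R" if "I \<in> \<A>" for I
      using integral_divisorialsD[of I] that \<A>(1) \<F>(1) by blast+
    have one: "\<one> \<in> ideal_inverse I" if "I \<in> \<A>" for I
      using dv(2)[OF that] R_closed unfolding ideal_inverse_def by (auto simp: subset_iff)
    have "\<Inter>\<A> = (\<Inter>I\<in>\<A>. ideal_inverse (ideal_inverse I))"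
      using dv(1) unfolding v_closure_def by simp
    also have "\<dots> = ideal_inverse (\<Union>I\<in>\<A>. ideal_inverse I)"
      using \<A>(2) unfolding ideal_inverse_def by blast
    finally have eq: "\<Inter>\<A> = ideal_inverse (\<Union>I\<in>\<A>. ideal_inverse I)" .
    show ?thesis
      unfolding eq
    proof (rule ideal_inverse_integral_divisorial)
      show "(\<Union>I\<in>\<A>. ideal_inverse I) \<subseteq> carrier K"
        using ideal_inverse_carrier by blast
      show "\<one> \<in> (\<Union>I\<in>\<A>. ideal_inverse I)"
        using one \<A>(2) by blast
      show "z \<in> ideal_inverse (\<Union>I\<in>\<A>. ideal_inverse I)"
        using z \<A>(1) unfolding eq[symmetric] by blast
    qed (fact assms(3))
  qed
  then have \<G>: "\<G> \<subseteq> integral_divisorials"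
    unfolding \<G>_def by blast
  obtain Q where "Q \<in> \<F>"
    using False by blast
  then have "\<Inter>{Q} \<in> \<G>"
    unfolding \<G>_def by (intro CollectI exI[of _ "{Q}"]) simp
  moreover have "z \<in> J" if "J \<in> \<G>" for J
    using that z unfolding \<G>_def by blast
  ultimately obtain M where M: "M \<in> \<G>" "\<And>J. J \<in> \<G> \<Longrightarrow> J \<subseteq> M \<Longrightarrow> J = M"
    using exists_minimal_divisorial[OF \<G> _ assms(2,3)] by metis
  then obtain \<A> where \<A>: "\<A> \<subseteq> \<F>" "finite \<A>" "\<A> \<noteq> {}" "M = \<Inter>\<A>"
    unfolding \<G>_def by blast
  have "Q \<in> \<A>" if Q: "Q \<in> \<F>" for Q
  proof (rule ccontr)
    assume "Q \<notin> \<A>"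
    have "\<Inter>(insert Q \<A>) \<in> \<G>"
      unfolding \<G>_def using \<A> Q by blast
    then have "\<Inter>\<A> \<subseteq> Q"
      using M(2) \<A>(4) by blast
    moreover have "ideal Q' (K\<lparr>carrier := R\<rparr>) \<and> \<not> Q' \<subseteq> Q" if "Q' \<in> \<A>" for Q'
      using that \<A>(1) maximal Q prime primeideal.axioms(1) \<open>Q \<notin> \<A>\<close> by blast
    then have "\<exists>t\<in>carrier (K\<lparr>carrier := R\<rparr>) - Q. \<forall>Q'\<in>\<A>. t \<in> Q'"
      using cring.exists_mem_ideals_diff_primeideal[OF R_cring \<A>(2)] prime[OF Q] by blast
    ultimately show False
      by blast
  qed
  then have "\<F> \<subseteq> \<A>"
    by (intro subsetI)
  then show ?thesis
    using \<A>(2) by (rule finite_subset)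
qed simp

section \<open>Regular pairs in divisorial overrings\<close>

text \<open>For \<open>w \<in> W\<close> the class of \<open>w \<otimes> z\<close> in T/zT is
  nonzero, and \<open>E w\<close> is its annihilator in \<open>R\<close>. The maximal annihilators
  are finitely many primes, none containing \<open>P\<close>, so prime avoidance yields
  \<open>y \<in> P\<close> outside all of them; such a \<open>y\<close> is regular on T/zT.\<close>

lemma exists_regular_pair:
  assumes T: "subring T K" "R \<subseteq> T" "T = ideal_inverse A" "A \<subseteq> carrier K"
    and P: "ideal P (K\<lparr>carrier := T\<rparr>)" "P \<subseteq> R"
    and colon: "\<And>w. w \<in> carrier K \<Longrightarrow> (\<And>p. p \<in> P \<Longrightarrow> w \<otimes> p \<in> T) \<Longrightarrow> w \<in> T"
    and z: "z \<in> P" "z \<noteq> \<zero>"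
  obtains y where "y \<in> P"
    "\<And>w. w \<in> carrier K \<Longrightarrow> w \<otimes> z \<in> T \<Longrightarrow> w \<otimes> y \<in> T \<Longrightarrow> w \<in> T"
proof -
  define W where "W = {w \<in> carrier K. w \<otimes> z \<in> T \<and> w \<notin> T}"
  define E where "E w = {a \<in> R. w \<otimes> a \<in> T}" for w
  define \<F> where "\<F> = {Q \<in> E ` W. \<forall>J \<in> E ` W. Q \<subseteq> J \<longrightarrow> J = Q}"
  have zR: "z \<in> R" "z \<in> carrier K"
    using z P R_closed by auto
  have T_mult: "r \<otimes> t \<in> T" if "r \<in> R" "t \<in> T" for r t
    using that subringE(6)[OF T(1)] T(2) by blast
  \<comment> \<open>As \<open>T\<close> is the inverse of \<open>A\<close>,
    \<open>w \<otimes> a \<in> T\<close> says that \<open>a\<close> multiplies wA into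
    \<open>R\<close>; the inserted \<open>\<one>\<close> expresses \<open>a \<in> R\<close>.\<close>
  have E_eq: "E w = ideal_inverse (insert \<one> ((\<lambda>a. w \<otimes> a) ` A))" if "w \<in> carrier K" for w
  proof -
    have "(w \<otimes> a) \<otimes> x = a \<otimes> (w \<otimes> x)" if "a \<in> carrier K" "x \<in> A" for a x
      using that \<open>w \<in> carrier K\<close> T(4) by (auto simp: m_ac)
    then have "a \<otimes> (w \<otimes> x) \<in> R \<longleftrightarrow> (w \<otimes> a) \<otimes> x \<in> R" if "a \<in> carrier K" "x \<in> A" for a x
      using that by simp
    then show ?thesis
      using that unfolding E_def T(3) ideal_inverse_def by (auto simp: R_closed)
  qed
  have zE: "z \<in> E w" if "w \<in> W" for w
    using that zR unfolding E_def W_def by blast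
  have E_div: "E w \<in> integral_divisorials" and E_ideal: "ideal (E w) (K\<lparr>carrier := R\<rparr>)"
    if "w \<in> W" for w
  proof -
    have w: "w \<in> carrier K"
      using that W_def by blast
    have "insert \<one> ((\<lambda>a. w \<otimes> a) ` A) \<subseteq> carrier K"
      using w T(4) by auto
    then show "E w \<in> integral_divisorials" "ideal (E w) (K\<lparr>carrier := R\<rparr>)"
      using ideal_inverse_integral_divisorial[of "insert \<one> ((\<lambda>a. w \<otimes> a) ` A)" z]
        ideal_inverse_integral_ideal(2)[of "insert \<one> ((\<lambda>a. w \<otimes> a) ` A)"]
        zE[OF that] z(2) unfolding E_eq[OF w] by auto
  qed
  \<comment> \<open>A maximal annihilator is prime: if \<open>b \<notin> E w\<close>, then
    \<open>w \<otimes> b\<close> is again in \<open>W\<close>, its annihilator contains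
    \<open>E w\<close>, and maximality makes them equal.\<close>
  have prime: "primeideal Q (K\<lparr>carrier := R\<rparr>)" if Q: "Q \<in> \<F>" for Q
  proof -
    obtain w where w: "w \<in> W" "Q = E w" and max: "\<And>J. J \<in> E ` W \<Longrightarrow> Q \<subseteq> J \<Longrightarrow> J = Q"
      using Q unfolding \<F>_def by blast
    have w_carr: "w \<in> carrier K"
      using w W_def by blast
    have "\<one> \<notin> Q"
      using w w_carr unfolding W_def E_def by auto
    moreover have "a \<in> Q" if ab: "a \<in> R" "b \<in> R" "a \<otimes> b \<in> Q" "b \<notin> Q" for a b
    proof -
      note carr = R_closed[OF ab(1)] R_closed[OF ab(2)] w_carr zR(2)
      have "w \<otimes> b \<notin> T"
        using ab w(2) unfolding E_def by blast
      moreover have "(w \<otimes> b) \<otimes> z = b \<otimes> (w \<otimes> z)"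
        using carr by (simp add: m_ac)
      ultimately have wb: "w \<otimes> b \<in> W"
        using T_mult[OF ab(2), of "w \<otimes> z"] w(1) carr unfolding W_def by auto
      have "E w \<subseteq> E (w \<otimes> b)"
      proof
        fix c assume c: "c \<in> E w"
        then have "(w \<otimes> b) \<otimes> c = b \<otimes> (w \<otimes> c)"
          using carr R_closed[of c] unfolding E_def by (auto simp: m_ac)
        then show "c \<in> E (w \<otimes> b)"
          using c T_mult[OF ab(2), of "w \<otimes> c"] unfolding E_def by auto
      qed
      then have "E (w \<otimes> b) = E w"
        using max[of "E (w \<otimes> b)"] wb w(2) by blast
      moreover have "(w \<otimes> b) \<otimes> a = w \<otimes> (a \<otimes> b)"
        using carr by (simp add: m_ac)
      then have "a \<in> E (w \<otimes> b)"
        using ab w(2) unfolding E_def by auto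
      ultimately show ?thesis
        using w(2) by blast
    qed
    moreover have "ideal Q (K\<lparr>carrier := R\<rparr>)"
      using E_ideal[OF w(1)] w(2) by blast
    ultimately show ?thesis
      by (intro primeideal_of_RI) blast+
  qed
  \<comment> \<open>Otherwise wP \<subseteq> T, and (T : P) = T gives
    \<open>w \<in> T\<close>.\<close>
  have "\<not> P \<subseteq> Q" if Q: "Q \<in> \<F>" for Q
  proof
    assume "P \<subseteq> Q"
    obtain w where w: "w \<in> W" "Q = E w"
      using Q unfolding \<F>_def by blast
    have "w \<in> T"
    proof (rule colon)
      show "w \<in> carrier K"
        using w(1) W_def by blast
      show "w \<otimes> p \<in> T" if "p \<in> P" for p
        using that \<open>P \<subseteq> Q\<close> w(2) E_def by blast
    qed
    then show False
      using w(1) W_def by blast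
  qed
  moreover have "finite \<F>"
  proof (rule finite_maximal_divisorials)
    show "\<F> \<subseteq> integral_divisorials"
      unfolding \<F>_def using E_div by blast
    show "\<And>I. I \<in> \<F> \<Longrightarrow> z \<in> I"
      unfolding \<F>_def using zE by blast
    show "\<And>Q Q'. Q \<in> \<F> \<Longrightarrow> Q' \<in> \<F> \<Longrightarrow> Q \<subseteq> Q' \<Longrightarrow> Q = Q'"
      unfolding \<F>_def by blast
  qed (use zR z prime in auto)
  moreover have "ideal P (K\<lparr>carrier := R\<rparr>)"
    using ideal_of_subringE[OF P(1)] P(2) T(2) by (intro ideal_of_subringI R_subring) auto
  ultimately obtain y where y: "y \<in> P" "\<And>Q. Q \<in> \<F> \<Longrightarrow> y \<notin> Q"
    using cring.prime_avoidance[OF R_cring] prime by metis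
  have "w \<in> T" if w: "w \<in> carrier K" "w \<otimes> z \<in> T" "w \<otimes> y \<in> T" for w
  proof (rule ccontr)
    assume "w \<notin> T"
    then have "E w \<in> E ` W"
      using w W_def by blast
    moreover have "E ` W \<subseteq> integral_divisorials"
      using E_div by blast
    ultimately obtain M where M: "M \<in> E ` W" "E w \<subseteq> M" "\<And>J. J \<in> E ` W \<Longrightarrow> M \<subseteq> J \<Longrightarrow> J = M"
      using exists_maximal_divisorial by metis
    then have "M \<in> \<F>"
      unfolding \<F>_def by blast
    moreover have "y \<in> E w"
      using w y P(2) unfolding E_def by blast
    ultimately show False
      using y(2) M(2) by blast
  qed
  then show thesis
    using that y(1) by blast
qed

end


section \<open>Polynomial values and analytic independence\<close>

text \<open>Values at \<open>v\<close> of polynomials over \<open>T\<close> of degree at most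
  \<open>n\<close>. The top term is split off so that it can be traded for a lower one, which the
  Horner form of \<open>simple_extension\<close> does not allow directly.\<close>

primrec (in ring) poly_values :: "'a set \<Rightarrow> 'a \<Rightarrow> nat \<Rightarrow> 'a set" where
  "poly_values T v 0 = T"
| "poly_values T v (Suc n) =
     {r \<otimes> v [^] Suc n \<oplus> s | r s. r \<in> T \<and> s \<in> poly_values T v n}"

lemma (in cring) poly_values_carrier:
  assumes "subring T R" "v \<in> carrier R" "q \<in> poly_values T v n"
  shows "q \<in> carrier R"
  using assms(3)
proof (induction n arbitrary: q)
  case 0
  then show ?case
    using subringE(1)[OF assms(1)] by auto
next
  case (Suc n)
  then obtain r s where "q = r \<otimes> v [^] Suc n \<oplus> s" "r \<in> T" "s \<in> poly_values T v n"
    by auto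
  then show ?case
    using Suc.IH[of s] subringE(1)[OF assms(1)] assms(2) by (simp add: subset_iff)
qed

lemma (in cring) poly_values_scale:
  assumes "subring T R" "v \<in> carrier R" "t \<in> T" "q \<in> poly_values T v n"
  shows "t \<otimes> q \<in> poly_values T v n"
  using assms(4)
proof (induction n arbitrary: q)
  case 0
  then show ?case
    using assms(3) subringE(6)[OF assms(1)] by simp
next
  case (Suc n)
  then obtain r s where q: "q = r \<otimes> v [^] Suc n \<oplus> s" "r \<in> T" "s \<in> poly_values T v n"
    by auto
  have carr: "r \<in> carrier R" "t \<in> carrier R" "s \<in> carrier R"
    using q assms(3) subringE(1)[OF assms(1)] poly_values_carrier[OF assms(1,2)] by auto
  have "t \<otimes> q = (t \<otimes> r) \<otimes> v [^] Suc n \<oplus> t \<otimes> s"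
    unfolding q(1) using carr assms(2) by (simp add: r_distr m_assoc del: nat_pow_Suc)
  then show ?case
    using Suc.IH[OF q(3)] subringE(6)[OF assms(1,3) q(2)] by auto
qed

lemma (in cring) poly_values_Horner:
  assumes "subring T R" "v \<in> carrier R" "r \<in> T" "q \<in> poly_values T v n"
  shows "q \<otimes> v \<oplus> r \<in> poly_values T v (Suc n)"
  using assms(4)
proof (induction n arbitrary: q)
  case 0
  then have "q \<in> carrier R"
    using subringE(1)[OF assms(1)] by auto
  then have "q \<otimes> v \<oplus> r = q \<otimes> v [^] Suc 0 \<oplus> r"
    using assms(2) by simp
  then show ?case
    using 0 assms(3) by (auto simp del: nat_pow_Suc)
next
  case (Suc n)
  then obtain a s where q: "q = a \<otimes> v [^] Suc n \<oplus> s" "a \<in> T" "s \<in> poly_values T v n"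
    by auto
  have carr: "a \<in> carrier R" "r \<in> carrier R" "s \<in> carrier R"
    using q assms(3) subringE(1)[OF assms(1)] poly_values_carrier[OF assms(1,2)] by auto
  have "q \<otimes> v \<oplus> r = a \<otimes> v [^] Suc (Suc n) \<oplus> (s \<otimes> v \<oplus> r)"
    unfolding q(1) using carr assms(2) by (simp add: l_distr m_assoc a_assoc)
  then show ?case
    using Suc.IH[OF q(3)] q(2) by (subst poly_values.simps(2)) blast
qed

text \<open>A second term of degree \<open>n\<close> merges with the leading coefficient.\<close>

lemma (in cring) poly_values_add_top:
  assumes "subring T R" "v \<in> carrier R" "r \<in> T" "q \<in> poly_values T v n"
  shows "r \<otimes> v [^] n \<oplus> q \<in> poly_values T v n"
proof (cases n)
  case 0
  then show ?thesis
    using assms subringE(1,7)[OF assms(1)] by auto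
next
  case (Suc m)
  then obtain a s where q: "q = a \<otimes> v [^] n \<oplus> s" "a \<in> T" "s \<in> poly_values T v m"
    using assms(4) by auto
  have carr: "a \<in> carrier R" "r \<in> carrier R" "s \<in> carrier R"
    using q assms(3) subringE(1)[OF assms(1)] poly_values_carrier[OF assms(1,2)] by auto
  have "r \<otimes> v [^] n \<oplus> q = (r \<oplus> a) \<otimes> v [^] Suc m \<oplus> s"
    unfolding q(1) Suc[symmetric] using carr assms(2) by (simp add: l_distr a_assoc)
  then show ?thesis
    unfolding Suc poly_values.simps(2) using q subringE(7)[OF assms(1,3) q(2)] by blast
qed

text \<open>In each term, \<open>n\<close> factors \<open>z\<close> suffice to turn the at most
  \<open>n\<close> factors \<open>v\<close> into \<open>v \<otimes> z\<close>.\<close>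

lemma (in cring) poly_values_clear_denominator:
  assumes T: "subring T R" "v \<in> carrier R" "z \<in> T" "v \<otimes> z \<in> T" "q \<in> poly_values T v n"
  shows "z [^] n \<otimes> q \<in> T"
  using assms(5)
proof (induction n arbitrary: q)
  case 0
  then show ?case
    using subringE(1)[OF T(1)] by auto
next
  case (Suc n)
  then obtain a s where q: "q = a \<otimes> v [^] Suc n \<oplus> s" "a \<in> T" "s \<in> poly_values T v n"
    by auto
  have carr: "a \<in> carrier R" "z \<in> carrier R" "s \<in> carrier R"
    using q T(3) subringE(1)[OF T(1)] poly_values_carrier[OF T(1,2)] by auto
  have pow: "(v \<otimes> z) [^] k \<in> T" for k :: nat
    using T(4) subringE(3,6)[OF T(1)] by (induction k) auto
  have "z [^] Suc n \<otimes> q = a \<otimes> (z [^] Suc n \<otimes> v [^] Suc n) \<oplus> z \<otimes> (z [^] n \<otimes> s)"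
    unfolding q(1) using carr T(2) by (simp add: r_distr m_ac)
  also have "z [^] Suc n \<otimes> v [^] Suc n = (v \<otimes> z) [^] Suc n"
    using carr T(2) by (subst nat_pow_distrib) (auto simp: m_comm)
  finally show ?case
    using Suc.IH[OF q(3)] q(2) T(3) pow[of "Suc n"] subringE(6,7)[OF T(1)] by metis
qed

lemma (in ring) simple_extension_poly_values:
  assumes "w \<in> simple_extension T v" "cring R" "subring T R" "v \<in> carrier R"
  shows "\<exists>n. w \<in> poly_values T v n"
  using assms(1)
proof (induction rule: simple_extension.induct)
  case zero
  then show ?case
    using subringE(2)[OF assms(3)] by (intro exI[of _ 0]) simp
next
  case (lin k r)
  then show ?case
    using cring.poly_values_Horner[OF assms(2-4)] by blast
qed

text \<open>A regular pair \<open>z, y\<close> is analytically independent: the leading coefficient of a relation for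
  \<open>v = y / z\<close> is divisible by \<open>z\<close>, so its top term can be merged into the next lower one.\<close>

lemma (in field) regular_pair_analytically_independent:
  assumes T: "subring T R" and P: "ideal P (R\<lparr>carrier := T\<rparr>)" "y \<in> P" "z \<in> P" "z \<noteq> \<zero>"
    and regular: "\<And>w. w \<in> carrier R \<Longrightarrow> w \<otimes> z \<in> T \<Longrightarrow> w \<otimes> y \<in> T \<Longrightarrow> w \<in> T"
    and v: "v \<in> carrier R" "v \<otimes> z = y"
    and rel: "q \<in> poly_values T v n" "t \<in> T" "t \<oplus> q \<otimes> v = \<zero>"
  shows "t \<in> P"
  using rel(1,3)
proof (induction n arbitrary: q)
  \<comment> \<open>In the relation, \<open>t\<close> is the constant term and
    \<open>q \<otimes> v\<close> collects the positive degrees. For constant \<open>q\<close>, the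
    quotient w = q/z satisfies wz = q and wy = qv = -t, both in \<open>T\<close>; regularity gives
    \<open>w \<in> T\<close>, so qv = wy lies in \<open>P\<close>.\<close>
  case 0
  then have q: "q \<in> T"
    by simp
  have z: "z \<in> T" "y \<in> T"
    using P ideal_of_subringE(1)[OF P(1)] by auto
  have carr: "q \<in> carrier R" "z \<in> carrier R" "t \<in> carrier R" "inv z \<in> carrier R"
    and inv_z: "inv z \<otimes> z = \<one>"
    using subringE(1)[OF T] q z rel(2) P(4) field_Units by auto
  define w where "w = q \<otimes> inv z"
  have w: "w \<in> carrier R" "w \<otimes> z = q"
    unfolding w_def using carr inv_z by (simp_all add: m_assoc)
  have "w \<otimes> y = (w \<otimes> z) \<otimes> v"
    unfolding v(2)[symmetric] using w(1) carr v(1) by (simp add: m_ac)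
  then have wy: "w \<otimes> y = q \<otimes> v"
    using w(2) by simp
  have t: "\<ominus> (q \<otimes> v) = t"
    using 0(2) carr v(1) by (simp add: minus_equality)
  then have "q \<otimes> v = \<ominus> t"
    using carr v(1) minus_minus[of "q \<otimes> v"] by simp
  then have "w \<otimes> y \<in> T"
    using wy subringE(5)[OF T rel(2)] by simp
  then have "w \<in> T"
    using regular[OF w(1)] w(2) q by simp
  then have "q \<otimes> v \<in> P"
    using ideal_of_subringE(4)[OF P(1) _ P(2)] wy by metis
  then show ?case
    using ideal_of_subringE_minus[OF T P(1)] t by metis
next
  case (Suc n)
  then obtain r s where q: "q = r \<otimes> v [^] Suc n \<oplus> s" "r \<in> T" "s \<in> poly_values T v n"
    by auto
  have z: "z \<in> T" "y \<in> T"
    using P ideal_of_subringE(1)[OF P(1)] by auto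
  have carr: "r \<in> carrier R" "s \<in> carrier R" "z \<in> carrier R" "y \<in> carrier R" "t \<in> carrier R"
    "inv z \<in> carrier R"
    and inv_z: "inv z \<otimes> z = \<one>"
    using subringE(1)[OF T] q z rel(2) P(4) field_Units poly_values_carrier[OF T v(1)] by auto
  \<comment> \<open>The aim is \<open>w \<in> T\<close>, that is, \<open>z\<close> divides the
    leading coefficient \<open>r\<close>.\<close>
  define w where "w = r \<otimes> inv z"
  have w: "w \<in> carrier R" "w \<otimes> z = r"
    unfolding w_def using carr inv_z by (simp_all add: m_assoc)
  have T_pow: "a [^] k \<in> T" if "a \<in> T" for a and k :: nat
    using that subringE(3,6)[OF T] by (induction k) auto
  have top: "r \<otimes> v [^] Suc (Suc n) = \<ominus> (t \<oplus> s \<otimes> v)"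
  proof -
    have "(t \<oplus> s \<otimes> v) \<oplus> r \<otimes> v [^] Suc (Suc n) = t \<oplus> q \<otimes> v"
      unfolding q(1) using carr v(1) by (simp add: l_distr m_assoc a_ac)
    then show ?thesis
      using Suc.prems(2) carr v(1) by (intro minus_equality[symmetric]) (auto simp: a_comm)
  qed
  \<comment> \<open>The relation has degree n+2, as \<open>q\<close> is multiplied by
    \<open>v\<close>. Times \<open>z [^] Suc n\<close>, its lower terms lie in \<open>T\<close>,
    hence so does the top one.\<close>
  have "w \<otimes> y [^] Suc (Suc n) = z [^] Suc n \<otimes> (r \<otimes> v [^] Suc (Suc n))"
  proof -
    have "w \<otimes> y [^] Suc (Suc n) = w \<otimes> (v [^] Suc (Suc n) \<otimes> z [^] Suc (Suc n))"
      unfolding v(2)[symmetric] using carr v(1) by (subst nat_pow_distrib) auto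
    also have "\<dots> = z [^] Suc n \<otimes> ((w \<otimes> z) \<otimes> v [^] Suc (Suc n))"
      unfolding nat_pow_Suc[of z] using w(1) carr v(1) by (simp add: m_ac del: nat_pow_Suc)
    finally show ?thesis
      using w(2) by simp
  qed
  also have "\<dots> = \<ominus> (t \<otimes> z [^] Suc n \<oplus> (z [^] n \<otimes> s) \<otimes> y)"
    unfolding top v(2)[symmetric] using carr v(1)
    by (simp add: r_minus r_distr m_ac)
  also have "\<dots> \<in> T"
  proof -
    have "z [^] n \<otimes> s \<in> T"
      using poly_values_clear_denominator[OF T v(1) z(1) _ q(3)] z v(2) by simp
    then show ?thesis
      using rel(2) z T_pow subringE(5-7)[OF T] by simp
  qed
  finally have wy: "w \<otimes> y [^] Suc (Suc n) \<in> T" .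
  \<comment> \<open>Regularity cancels the factors \<open>y\<close> one at a time; the condition on
    \<open>z\<close> holds because wz = r is in \<open>T\<close>.\<close>
  have "w \<in> T" if "w \<otimes> y [^] k \<in> T" for k :: nat
    using that
  proof (induction k)
    case 0
    then show ?case
      using w by simp
  next
    case (Suc k)
    have "(w \<otimes> y [^] k) \<otimes> z = (w \<otimes> z) \<otimes> y [^] k"
      using w(1) carr by (simp add: m_ac)
    then have "(w \<otimes> y [^] k) \<otimes> z \<in> T"
      using w(2) q(2) T_pow z subringE(6)[OF T] by simp
    moreover have "(w \<otimes> y [^] k) \<otimes> y \<in> T"
      using Suc.prems w(1) carr by (simp add: m_assoc)
    ultimately have "w \<otimes> y [^] k \<in> T"
      using regular[of "w \<otimes> y [^] k"] w(1) carr by simp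
    then show ?case
      by (rule Suc.IH)
  qed
  from this[OF wy] have "w \<in> T" .
  then have "w \<otimes> y \<in> T"
    using subringE(6)[OF T _ z(2)] by blast
  \<comment> \<open>Since r = wz and vz = y, the top term of \<open>q\<close> is (wy)v^n, so
    \<open>q\<close> already is a value of degree at most \<open>n\<close>.\<close>
  then have "(w \<otimes> y) \<otimes> v [^] n \<oplus> s \<in> poly_values T v n"
    using poly_values_add_top[OF T v(1) _ q(3)] by blast
  moreover have "(w \<otimes> y) \<otimes> v [^] n = r \<otimes> v [^] Suc n"
    unfolding w(2)[symmetric] v(2)[symmetric] using w(1) carr v(1) by (simp add: m_ac)
  ultimately show ?case
    using Suc.IH[of q] Suc.prems(2) q(1) by simp
qed

section \<open>The key step and complete integral closedness\<close>

locale mori_sQQR_domain = mori_domain R K + sQQR_domain R K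
  for R :: "'a set" and K :: "('a, 'b) ring_scheme" (structure)
begin

lemma one_mem_of_trivial_colon:
  assumes T: "subring T K" "R \<subseteq> T" "T = ideal_inverse A" "A \<subseteq> carrier K"
    and P: "ideal P (K\<lparr>carrier := T\<rparr>)" "P \<subseteq> R" "P \<noteq> {\<zero>}"
    and colon: "\<And>w. w \<in> carrier K \<Longrightarrow> (\<And>p. p \<in> P \<Longrightarrow> w \<otimes> p \<in> T) \<Longrightarrow> w \<in> T"
  shows "\<one> \<in> P"
proof -
  note P_ideal = ideal_of_subringE[OF P(1)]
  obtain z where z: "z \<in> P" "z \<noteq> \<zero>"
    using P(3) P_ideal(2) by blast
  obtain y where y: "y \<in> P"
    and regular: "\<And>w. w \<in> carrier K \<Longrightarrow> w \<otimes> z \<in> T \<Longrightarrow> w \<otimes> y \<in> T \<Longrightarrow> w \<in> T"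
    using exists_regular_pair[OF T P(1,2) colon z] by metis
  have zy: "z \<in> R" "y \<in> R" "z \<in> carrier K" "y \<in> carrier K"
    using z y P(2) R_closed by auto
  note inv_z = inv_nonzero[OF zy(3) z(2)]
  define v where "v = y \<otimes> inv z"
  have v: "v \<in> carrier K" "v \<otimes> z = y"
    unfolding v_def using zy inv_z by (simp_all add: m_assoc)
  obtain \<P> where \<P>: "\<And>p. p \<in> \<P> \<Longrightarrow> primeideal p (K\<lparr>carrier := R\<rparr>)"
    "simple_extension R v = carrier K \<inter> (\<Inter>p\<in>\<P>. localization p)"
    using simple_overring[OF v(1)] unfolding intersection_of_localizations_def by blast
  \<comment> \<open>Let \<open>b\<close> outside \<open>p\<close> be a denominator of
    \<open>v\<close>. Regularity puts w = b/z into \<open>T\<close>. If \<open>z\<close> were in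
    \<open>p\<close>, then b^2 = (w^2 z)z would be too, since w^2 z \<in> P \<subseteq> R. So
    \<open>z\<close> is a denominator outside \<open>p\<close>.\<close>
  have "inv z \<in> localization p" if p: "p \<in> \<P>" for p
  proof -
    have "v \<in> localization p"
      using simple_extension_mem[OF R_subring v(1)] \<P>(2) p by blast
    then obtain b where b: "b \<in> R - p" "b \<noteq> \<zero>" "v \<otimes> b \<in> R"
      using localizationE[OF _ \<P>(1)[OF p]] by blast
    have b_carr: "b \<in> carrier K"
      using b R_closed by blast
    define w where "w = b \<otimes> inv z"
    have w: "w \<in> carrier K" "w \<otimes> z = b"
      unfolding w_def using b_carr inv_z zy by (simp_all add: m_assoc)
    have "w \<otimes> y = v \<otimes> b"
      unfolding w_def v_def using b_carr inv_z zy by (simp add: m_ac)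
    then have wT: "w \<in> T"
      using regular[OF w(1)] w(2) b T(2) by auto
    have "z \<notin> p"
    proof
      assume "z \<in> p"
      have "(w \<otimes> w) \<otimes> z \<in> R"
        using P_ideal(4)[OF subringE(6)[OF T(1) wT wT] z(1)] P(2) by blast
      then have "((w \<otimes> w) \<otimes> z) \<otimes> z \<in> p"
        using ideal_of_subringE(4)[OF primeideal_of_RE(1)[OF \<P>(1)[OF p]] _ \<open>z \<in> p\<close>] by blast
      moreover have "((w \<otimes> w) \<otimes> z) \<otimes> z = b \<otimes> b"
        unfolding w(2)[symmetric] using w(1) zy by (simp add: m_ac)
      ultimately show False
        using primeideal_of_RE(4)[OF \<P>(1)[OF p], of b b] b(1) by auto
    qed
    then show ?thesis
      using zy z(2) inv_z R_one by (intro fraction_in_localization[of _ z]) auto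
  qed
  then have "inv z \<in> simple_extension R v"
    using inv_z \<P>(2) by blast
  then have "inv z \<in> simple_extension T v"
    using mono_simple_extension[OF T(2)] by blast
  \<comment> \<open>Since \<open>inv z\<close> is nonzero, the base case of
    \<open>simple_extension\<close> is excluded.\<close>
  then obtain q r where qr: "inv z = q \<otimes> v \<oplus> r" "q \<in> simple_extension T v" "r \<in> T"
    using inv_z(2) by (cases rule: simple_extension.cases) auto
  obtain n where n: "q \<in> poly_values T v n"
    using simple_extension_poly_values[OF qr(2) cring_axioms T(1) v(1)] by blast
  have zT: "z \<in> T"
    using zy T(2) by blast
  have carr: "q \<in> carrier K" "r \<in> carrier K"
    using poly_values_carrier[OF T(1) v(1) n] qr(3) subringE(1)[OF T(1)] by auto
  \<comment> \<open>Multiplying by \<open>z\<close> gives a relation for \<open>v\<close> with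
    constant term \<open>r \<otimes> z \<ominus> \<one>\<close>. Independence puts this into
    \<open>P\<close>, which also contains \<open>r \<otimes> z\<close>; the difference is
    \<open>\<one>\<close>.\<close>
  have "\<one> = z \<otimes> (q \<otimes> v \<oplus> r)"
    using inv_z(3) qr(1) by simp
  also have "\<dots> = (z \<otimes> q) \<otimes> v \<oplus> r \<otimes> z"
    using carr zy v(1) by (simp add: r_distr m_ac)
  finally have one: "\<one> = (z \<otimes> q) \<otimes> v \<oplus> r \<otimes> z" .
  have rz: "r \<otimes> z \<in> P"
    using P_ideal(4)[OF qr(3) z(1)] .
  have "r \<otimes> z \<ominus> \<one> \<in> T"
    unfolding a_minus_def using rz P_ideal(1) subringE(3,5,7)[OF T(1)] by blast
  moreover have "(r \<otimes> z \<ominus> \<one>) \<oplus> (z \<otimes> q) \<otimes> v = \<zero>"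
  proof -
    have "(r \<otimes> z \<ominus> \<one>) \<oplus> (z \<otimes> q) \<otimes> v = ((z \<otimes> q) \<otimes> v \<oplus> r \<otimes> z) \<ominus> \<one>"
      using carr zy v(1) by algebra
    then show ?thesis
      unfolding one[symmetric] by (simp add: a_minus_def r_neg)
  qed
  ultimately have "r \<otimes> z \<ominus> \<one> \<in> P"
    using regular_pair_analytically_independent[OF T(1) P(1) y z regular v
        poly_values_scale[OF T(1) v(1) zT n]] by blast
  then have "r \<otimes> z \<oplus> \<ominus> (r \<otimes> z \<ominus> \<one>) \<in> P"
    using P_ideal(3)[OF rz] ideal_of_subringE_minus[OF T(1) P(1)] by blast
  moreover have "r \<otimes> z \<oplus> \<ominus> (r \<otimes> z \<ominus> \<one>) = \<one>"
    using carr zy by algebra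
  ultimately show ?thesis
    by simp
qed

text \<open>If \<open>P = (R : x)\<close> is maximal among the conductors of almost integral elements outside
  \<open>R\<close>, then \<open>x P \<subseteq> P\<close> and the intersection property of \<open>R[x]\<close> gives
  \<open>R[x] = (R : P) = (R : P\<^sup>2)\<close>.\<close>

lemma almost_integral_mem_R:
  assumes "almost_integral x0"
  shows "x0 \<in> R"
proof (rule ccontr)
  assume "x0 \<notin> R"
  \<comment> \<open>This is (R : w), written as an inverse so that it is divisorial for almost
    integral \<open>w\<close>.\<close>
  define conductor where "conductor w = ideal_inverse {\<one>, w}" for w
  have conductor_iff: "a \<in> conductor w \<longleftrightarrow> a \<in> R \<and> a \<otimes> w \<in> R" for a w
    unfolding conductor_def ideal_inverse_def using R_closed by auto
  define \<F> where "\<F> = conductor ` {w. almost_integral w \<and> w \<notin> R}"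
  have AI_carr: "w \<in> carrier K" if "almost_integral w" for w
    using that unfolding almost_integral_def by blast
  have "conductor w \<in> integral_divisorials" if w: "almost_integral w" for w
  proof -
    obtain c where c: "c \<in> R" "c \<noteq> \<zero>" "\<And>k::nat. c \<otimes> w [^] k \<in> R"
      using w unfolding almost_integral_def by blast
    have "c \<in> conductor w"
      using c(1) c(3)[of 1] AI_carr[OF w] conductor_iff by simp
    then show ?thesis
      using AI_carr[OF w] c(2) unfolding conductor_def
      by (intro ideal_inverse_integral_divisorial) auto
  qed
  then have "\<F> \<subseteq> integral_divisorials"
    unfolding \<F>_def by blast
  moreover have "conductor x0 \<in> \<F>"
    using assms \<open>x0 \<notin> R\<close> unfolding \<F>_def by blast
  ultimately obtain P where P: "P \<in> \<F>" and maximal: "\<And>J. J \<in> \<F> \<Longrightarrow> P \<subseteq> J \<Longrightarrow> J = P"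
    using exists_maximal_divisorial by metis
  then obtain x where x: "almost_integral x" "x \<notin> R" "P = conductor x"
    unfolding \<F>_def by auto
  have P_iff: "a \<in> P \<longleftrightarrow> a \<in> R \<and> a \<otimes> x \<in> R" for a
    unfolding x(3) by (rule conductor_iff)
  have x_carr: "x \<in> carrier K"
    using AI_carr x(1) by blast
  have PR: "P \<subseteq> R"
    using P_iff by blast
  have one: "\<one> \<notin> P"
    using x(2) x_carr P_iff by simp
  \<comment> \<open>The element \<open>b \<otimes> x\<close> is again almost integral and, as
    \<open>b \<notin> P\<close>, outside \<open>R\<close>; so its conductor, which contains
    \<open>P\<close>, equals \<open>P\<close>.\<close>
  have prime: "a \<in> P" if ab: "a \<in> R" "b \<in> R" "a \<otimes> b \<in> P" "b \<notin> P" for a b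
  proof -
    note carr = R_closed[OF ab(1)] R_closed[OF ab(2)] x_carr
    have "conductor (b \<otimes> x) \<in> \<F>"
      using almost_integral_mult[OF x(1) ab(2)] ab P_iff unfolding \<F>_def by blast
    moreover have "P \<subseteq> conductor (b \<otimes> x)"
    proof
      fix c assume c: "c \<in> P"
      then have "c \<otimes> (b \<otimes> x) = b \<otimes> (c \<otimes> x)"
        using carr P_iff R_closed by (simp add: m_ac)
      then show "c \<in> conductor (b \<otimes> x)"
        using c P_iff conductor_iff R_mult[OF ab(2)] by simp
    qed
    ultimately have "conductor (b \<otimes> x) = P"
      by (rule maximal)
    moreover have "a \<otimes> (b \<otimes> x) \<in> R"
      using ab(3) P_iff carr by (simp add: m_assoc)
    ultimately show ?thesis
      using ab(1) conductor_iff by blast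
  qed
  have prime_pow: "q \<in> P" if "q \<in> R" "q [^] k \<in> P" for q and k :: nat
    using that(2)
  proof (induction k)
    case 0
    then show ?case
      using one by simp
  next
    case (Suc k)
    then show ?case
      using prime[of q "q [^] k"] that(1) R_pow[OF that(1)] R_closed[OF that(1)]
      by (cases "q [^] k \<in> P") (auto simp: m_comm)
  qed
  have xP: "x \<otimes> p \<in> P" if p: "p \<in> P" for p
  proof -
    obtain c where c: "c \<in> R" "c \<noteq> \<zero>" "\<And>k::nat. c \<otimes> x [^] k \<in> R"
      using x(1) unfolding almost_integral_def by blast
    \<comment> \<open>Common denominators of 1, x, ..., x^k. The chain descends and always contains
      \<open>c\<close>, so it has a minimal member \<open>I N\<close>, and
      \<open>I (Suc N) = I N\<close>. As \<open>p [^] N\<close> is in \<open>I N\<close>, it also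
      clears x^(N+1).\<close>
    define I where "I k = ideal_inverse ((\<lambda>i::nat. x [^] i) ` {..k})" for k
    have c_mem: "c \<in> I k" for k
      using c R_closed unfolding I_def ideal_inverse_def by auto
    have "I k \<in> integral_divisorials" for k
      unfolding I_def
    proof (rule ideal_inverse_integral_divisorial)
      show "\<one> \<in> (\<lambda>i::nat. x [^] i) ` {..k}"
        using x_carr by (intro image_eqI[of _ _ 0]) auto
    qed (use x_carr c(2) c_mem I_def in auto)
    then have "range I \<subseteq> integral_divisorials" "I 0 \<in> range I"
      by auto
    then obtain M where "M \<in> range I" and min: "\<And>J. J \<in> range I \<Longrightarrow> J \<subseteq> M \<Longrightarrow> J = M"
      using exists_minimal_divisorial[of "range I" "I 0" c] c(1,2) c_mem R_closed by (metis rangeE)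
    then obtain N where N: "M = I N"
      by blast
    have "I (Suc N) \<subseteq> I N"
      unfolding I_def by (intro ideal_inverse_antimono) auto
    then have stable: "I (Suc N) = I N"
      using min N by blast
    have p': "p \<in> R" "p \<in> carrier K" "p \<otimes> x \<in> R" "x \<otimes> p \<in> R"
      using p P_iff R_closed x_carr by (auto simp: m_comm)
    have "p [^] N \<otimes> x [^] i \<in> R" if "i \<le> N" for i
    proof -
      have "p [^] N = p [^] (N - i) \<otimes> p [^] i"
        using that p'(2) by (simp add: nat_pow_mult)
      then have "p [^] N \<otimes> x [^] i = p [^] (N - i) \<otimes> (p \<otimes> x) [^] i"
        using p'(2) x_carr by (simp add: nat_pow_distrib m_ac)
      then show ?thesis
        using R_mult R_pow p' by simp
    qed
    then have "p [^] N \<in> I N"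
      using p'(2) unfolding I_def ideal_inverse_def by auto
    then have "p [^] N \<otimes> x [^] Suc N \<in> R"
      unfolding stable[symmetric] unfolding I_def ideal_inverse_def by blast
    \<comment> \<open>Read this way, (xp)^N lies in (R : x) = P, and primality removes the
      exponent.\<close>
    moreover have "p [^] N \<otimes> x [^] Suc N = (x \<otimes> p) [^] N \<otimes> x"
      using p'(2) x_carr by (simp add: nat_pow_distrib m_ac)
    ultimately have "(x \<otimes> p) [^] N \<in> P"
      using P_iff R_pow[OF p'(4)] by simp
    then show ?thesis
      using prime_pow p'(4) by blast
  qed
  have P_ideal: "ideal P (K\<lparr>carrier := R\<rparr>)"
    unfolding x(3) conductor_def using x_carr by (intro ideal_inverse_integral_ideal) auto
  note P_R = ideal_of_subringE[OF P_ideal]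
  define T where "T = simple_extension R x"
  have T: "subring T K" "R \<subseteq> T"
    unfolding T_def using simple_extension_is_subring[OF R_subring x_carr]
      simple_extension_incl[OF subringE(1)[OF R_subring] x_carr] by blast+
  obtain \<P> where \<P>: "\<And>p. p \<in> \<P> \<Longrightarrow> primeideal p (K\<lparr>carrier := R\<rparr>)"
    "T = carrier K \<inter> (\<Inter>p\<in>\<P>. localization p)"
    using simple_overring[OF x_carr] unfolding intersection_of_localizations_def T_def by blast
  \<comment> \<open>If \<open>x\<close> lies in the localization at \<open>p\<close>, it has a
    denominator \<open>b\<close> outside \<open>p\<close>. Then \<open>b \<in> P\<close>, as
    \<open>P\<close> is the conductor of \<open>x\<close>, so b^2 is a denominator of
    \<open>y\<close> outside \<open>p\<close>.\<close>
  have mem_T: "y \<in> T" if y: "y \<in> carrier K" "\<And>a b. a \<in> P \<Longrightarrow> b \<in> P \<Longrightarrow> (y \<otimes> a) \<otimes> b \<in> R" for y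
  proof -
    have "y \<in> localization p" if p: "p \<in> \<P>" for p
    proof -
      have "x \<in> localization p"
        using simple_extension_mem[OF R_subring x_carr] \<P>(2) p unfolding T_def by blast
      then obtain b where b: "b \<in> R - p" "b \<noteq> \<zero>" "x \<otimes> b \<in> R"
        using localizationE[OF _ \<P>(1)[OF p]] by blast
      have b_carr: "b \<in> carrier K"
        using b R_closed by blast
      have "b \<in> P"
        using P_iff b x_carr b_carr by (simp add: m_comm)
      then have "y \<otimes> (b \<otimes> b) \<in> R"
        using y b_carr by (simp add: m_assoc[symmetric])
      moreover have "b \<otimes> b \<in> R - p"
        using primeideal_of_RE(4)[OF \<P>(1)[OF p], of b b] b(1) R_mult by blast
      moreover have "b \<otimes> b \<noteq> \<zero>"
        using b(2) b_carr by (simp add: integral_iff)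
      ultimately show ?thesis
        using y(1) by (intro fraction_in_localization[of y "b \<otimes> b"]) auto
    qed
    then show ?thesis
      using y(1) \<P>(2) by blast
  qed
  have TP: "w \<otimes> a \<in> P" if "w \<in> T" "a \<in> P" for w a
    using that unfolding T_def
  proof (induction arbitrary: a rule: simple_extension.induct)
    case zero
    then show ?case
      using P_R(1,2) R_closed by auto
  next
    case (lin k r)
    have "k \<in> carrier K"
      using lin(1) simple_extension_in_carrier[of R x] R_closed x_carr by blast
    then have "(k \<otimes> x \<oplus> r) \<otimes> a = k \<otimes> (x \<otimes> a) \<oplus> r \<otimes> a"
      using lin(2,4) x_carr P_R(1) R_closed by (simp add: l_distr m_assoc subset_iff)
    then show ?case
      using lin P_R(3,4) xP by simp
  qed
  have T_eq: "T = ideal_inverse P"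
  proof
    show "T \<subseteq> ideal_inverse P"
      using TP PR subringE(1)[OF T(1)] unfolding ideal_inverse_def by blast
    show "ideal_inverse P \<subseteq> T"
      using PR R_mult unfolding ideal_inverse_def by (auto intro!: mem_T)
  qed
  have "\<one> \<in> P"
  proof (rule one_mem_of_trivial_colon[OF T T_eq])
    show "P \<subseteq> carrier K" "P \<subseteq> R"
      using PR R_closed by auto
    show "ideal P (K\<lparr>carrier := T\<rparr>)"
      using P_R PR T TP by (intro ideal_of_subringI) auto
    obtain d where "d \<in> R" "d \<noteq> \<zero>" "x \<otimes> d \<in> R"
      using exists_denominator[OF x_carr] by blast
    then show "P \<noteq> {\<zero>}"
      using P_iff[of d] x_carr R_closed by (auto simp: m_comm)
    \<comment> \<open>From wP \<subseteq> T follows that P^2 is multiplied by \<open>w\<close> into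
      TP \<subseteq> P \<subseteq> R.\<close>
    show "w \<in> T" if w: "w \<in> carrier K" "\<And>p. p \<in> P \<Longrightarrow> w \<otimes> p \<in> T" for w
    proof (rule mem_T[OF w(1)])
      fix a b assume "a \<in> P" "b \<in> P"
      then show "(w \<otimes> a) \<otimes> b \<in> R"
        using TP[OF w(2)] PR by blast
    qed
  qed
  then show False
    using one by contradiction
qed

section \<open>Finite generation of ideals and maximality of nonzero primes\<close>

text \<open>The key step for \<open>T = R\<close>, the inverse of \<open>{\<one>}\<close>. As almost
  integral elements lie in \<open>R\<close>, almost integrality is enough in the colon
  condition.\<close>

lemma one_mem_ideal_of_trivial_colon:
  assumes "ideal H (K\<lparr>carrier := R\<rparr>)" "H \<noteq> {\<zero>}"
    and "\<And>w. w \<in> carrier K \<Longrightarrow> (\<And>h. h \<in> H \<Longrightarrow> w \<otimes> h \<in> R) \<Longrightarrow> almost_integral w"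
  shows "\<one> \<in> H"
proof (rule one_mem_of_trivial_colon[OF R_subring order_refl])
  show "R = ideal_inverse {\<one>}"
    unfolding ideal_inverse_def using R_closed by auto
  show "H \<subseteq> R"
    using ideal_of_subringE(1)[OF assms(1)] .
  show "w \<in> R" if "w \<in> carrier K" "\<And>h. h \<in> H \<Longrightarrow> w \<otimes> h \<in> R" for w
    using assms(3)[OF that] by (rule almost_integral_mem_R)
qed (use assms(1,2) in auto)

text \<open>An ideal \<open>I\<close> is finitely generated once \<open>1\<close> lies in the ideal of all \<open>h\<close> such that \<open>h I\<close> is
  contained in a finitely generated subideal of \<open>I\<close>, and this ideal contains \<open>I I\<inverse>\<close>.\<close>

lemma ideal_finitely_generated:
  assumes I: "ideal I (K\<lparr>carrier := R\<rparr>)"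
  shows "\<exists>A \<subseteq> I. finite A \<and> I = Idl\<^bsub>K\<lparr>carrier := R\<rparr>\<^esub> A"
proof (cases "I = {\<zero>}")
  case True
  interpret RR: cring "K\<lparr>carrier := R\<rparr>"
    using R_cring .
  have "Idl\<^bsub>K\<lparr>carrier := R\<rparr>\<^esub> I = I"
    using RR.genideal_minimal[OF I order_refl] RR.genideal_self[of I] ideal_of_subringE(1)[OF I]
    by auto
  then show ?thesis
    using True by (intro exI[of _ I]) auto
next
  case False
  interpret RR: cring "K\<lparr>carrier := R\<rparr>"
    using R_cring .
  note I_R = ideal_of_subringE[OF I]
  obtain a0 where a0: "a0 \<in> I" "a0 \<noteq> \<zero>"
    using False I_R(2) by blast
  have a0_R: "a0 \<in> R" "a0 \<in> carrier K"
    using a0 I_R(1) R_closed by auto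
  let ?Idl = "\<lambda>A. Idl\<^bsub>K\<lparr>carrier := R\<rparr>\<^esub> A"
  have Idl_ideal: "ideal (?Idl A) (K\<lparr>carrier := R\<rparr>)" if "A \<subseteq> I" for A
    using that I_R(1) by (intro RR.genideal_ideal) auto
  have Idl_mono: "?Idl A \<subseteq> ?Idl B" if "A \<subseteq> B" "B \<subseteq> I" for A B
    using that RR.genideal_self[of B] I_R(1) by (intro RR.genideal_minimal Idl_ideal) auto
  define H where "H = {h \<in> R. \<exists>A \<subseteq> I. finite A \<and> (\<forall>x\<in>I. h \<otimes> x \<in> ?Idl A)}"
  \<comment> \<open>One generator is enough here: (az)x = (zx)a is a multiple of
    \<open>a\<close>.\<close>
  have product: "a \<otimes> z \<in> H" if az: "a \<in> I" "z \<in> carrier K" "\<And>x. x \<in> I \<Longrightarrow> z \<otimes> x \<in> R" for a z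
  proof -
    have a: "a \<in> R" "a \<in> carrier K"
      using az(1) I_R(1) R_closed by auto
    have "(a \<otimes> z) \<otimes> x \<in> ?Idl {a}" if x: "x \<in> I" for x
    proof -
      have "(a \<otimes> z) \<otimes> x = (z \<otimes> x) \<otimes> a"
        using a az(2) x I_R(1) R_closed by (simp add: m_ac subset_iff)
      moreover have "a \<in> ?Idl {a}"
        using RR.genideal_self[of "{a}"] a by auto
      ultimately show ?thesis
        using ideal_of_subringE(4)[OF Idl_ideal, of "{a}" "z \<otimes> x" a] az(1) az(3)[OF x] by simp
    qed
    moreover have "a \<otimes> z \<in> R"
      using az(3)[OF az(1)] a az(2) by (simp add: m_comm)
    ultimately show ?thesis
      unfolding H_def using az(1) by blast
  qed
  have "\<one> \<in> H"
  proof (rule one_mem_ideal_of_trivial_colon)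
    show "ideal H (K\<lparr>carrier := R\<rparr>)"
    proof (rule ideal_of_subringI[OF R_subring])
      have "\<zero> \<otimes> x \<in> ?Idl {}" if "x \<in> I" for x
        using that ideal_of_subringE(2)[OF Idl_ideal, of "{}"] I_R(1) R_closed
        by (simp add: subset_iff)
      then show "\<zero> \<in> H"
        unfolding H_def using R_zero by blast
    next
      fix h h' assume "h \<in> H" "h' \<in> H"
      then obtain A A' where A: "h \<in> R" "A \<subseteq> I" "finite A" "\<And>x. x \<in> I \<Longrightarrow> h \<otimes> x \<in> ?Idl A"
        and A': "h' \<in> R" "A' \<subseteq> I" "finite A'" "\<And>x. x \<in> I \<Longrightarrow> h' \<otimes> x \<in> ?Idl A'"
        unfolding H_def by auto
      have "(h \<oplus> h') \<otimes> x \<in> ?Idl (A \<union> A')" if x: "x \<in> I" for x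
      proof -
        have "(h \<oplus> h') \<otimes> x = h \<otimes> x \<oplus> h' \<otimes> x"
          using A(1) A'(1) x I_R(1) R_closed by (simp add: l_distr subset_iff)
        moreover have "h \<otimes> x \<in> ?Idl (A \<union> A')" "h' \<otimes> x \<in> ?Idl (A \<union> A')"
          using A(2,4) A'(2,4) x Idl_mono[of A "A \<union> A'"] Idl_mono[of A' "A \<union> A'"] by auto
        ultimately show ?thesis
          using ideal_of_subringE(3)[OF Idl_ideal] A(2) A'(2) by simp
      qed
      moreover have "h \<oplus> h' \<in> R" "A \<union> A' \<subseteq> I" "finite (A \<union> A')"
        using A A' R_add by auto
      ultimately show "h \<oplus> h' \<in> H"
        unfolding H_def by blast
    next
      fix t h assume t: "t \<in> R" and "h \<in> H"
      then obtain A where A: "h \<in> R" "A \<subseteq> I" "finite A" "\<And>x. x \<in> I \<Longrightarrow> h \<otimes> x \<in> ?Idl A"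
        unfolding H_def by auto
      have "(t \<otimes> h) \<otimes> x \<in> ?Idl A" if x: "x \<in> I" for x
      proof -
        have "(t \<otimes> h) \<otimes> x = t \<otimes> (h \<otimes> x)"
          using A(1) t x I_R(1) R_closed by (simp add: m_assoc subset_iff)
        then show ?thesis
          using ideal_of_subringE(4)[OF Idl_ideal[OF A(2)] t A(4)[OF x]] by simp
      qed
      then show "t \<otimes> h \<in> H"
        unfolding H_def using A(2,3) R_mult[OF t A(1)] by blast
    qed (auto simp: H_def)
    \<comment> \<open>\<open>\<one>\<close> belongs to the inverse of \<open>I\<close> because
      \<open>I \<subseteq> R\<close>.\<close>
    have "a0 \<otimes> \<one> \<in> H"
      using I_R(1) R_closed by (intro product a0) auto
    then show "H \<noteq> {\<zero>}"
      using a0 a0_R by auto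
    show "almost_integral w" if w: "w \<in> carrier K" "\<And>h. h \<in> H \<Longrightarrow> w \<otimes> h \<in> R" for w
    proof (rule almost_integralI_invariant)
      \<comment> \<open>As \<open>H\<close> contains the products of \<open>I\<close> with its
        inverse, \<open>w\<close> maps this inverse into itself; the factor \<open>a0\<close> moves
        it into \<open>R\<close>.\<close>
      let ?M = "{a0 \<otimes> z | z. z \<in> ideal_inverse I}"
      have "a0 \<otimes> \<one> \<in> ?M"
        using I_R(1) R_closed unfolding ideal_inverse_def by (auto simp: subset_iff)
      then show "a0 \<in> ?M"
        using a0_R by simp
      show "?M \<subseteq> R"
        using a0 a0_R unfolding ideal_inverse_def by (auto simp: m_comm)
      fix b assume "b \<in> ?M"
      then obtain z where z: "b = a0 \<otimes> z" "z \<in> carrier K" "\<And>x. x \<in> I \<Longrightarrow> z \<otimes> x \<in> R"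
        unfolding ideal_inverse_def by blast
      have "(w \<otimes> z) \<otimes> x \<in> R" if x: "x \<in> I" for x
      proof -
        have "(w \<otimes> z) \<otimes> x = w \<otimes> (x \<otimes> z)"
          using w(1) z(2) x I_R(1) R_closed by (simp add: m_ac subset_iff)
        then show ?thesis
          using w(2)[OF product[OF x z(2,3)]] by simp
      qed
      then have "w \<otimes> z \<in> ideal_inverse I"
        using w(1) z(2) unfolding ideal_inverse_def by simp
      moreover have "w \<otimes> b = a0 \<otimes> (w \<otimes> z)"
        unfolding z(1) using w(1) z(2) a0_R by (simp add: m_ac)
      ultimately show "w \<otimes> b \<in> ?M"
        by blast
    qed (use a0 w in auto)
  qed
  then obtain A where A: "A \<subseteq> I" "finite A" "\<And>x. x \<in> I \<Longrightarrow> \<one> \<otimes> x \<in> ?Idl A"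
    unfolding H_def by auto
  have "I \<subseteq> ?Idl A"
    using A(3) I_R(1) R_closed by (simp add: subset_iff)
  moreover have "?Idl A \<subseteq> I"
    using A(1) by (intro RR.genideal_minimal I)
  ultimately show ?thesis
    using A(1,2) by blast
qed

text \<open>Let \<open>J\<close> properly contain \<open>P\<close> and take \<open>j\<close> in
  \<open>J\<close> outside \<open>P\<close>. If wJ \<subseteq> R, then (wa)j = (wj)a \<in> P for
  \<open>a \<in> P\<close>, so wP \<subseteq> P by primality. Thus \<open>w\<close> is almost
  integral, which yields \<open>\<one> \<in> J\<close>.\<close>

lemma nonzero_primeideal_maximal:
  assumes P: "primeideal P (K\<lparr>carrier := R\<rparr>)" "P \<noteq> {\<zero>}"
  shows "maximalideal P (K\<lparr>carrier := R\<rparr>)"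
proof (rule maximalidealI)
  note P' = primeideal_of_RE[OF P(1)]
  note P_R = ideal_of_subringE[OF P'(1)]
  show "ideal P (K\<lparr>carrier := R\<rparr>)" "carrier (K\<lparr>carrier := R\<rparr>) \<noteq> P"
    using P'(1,3) R_one by auto
  fix J assume J: "ideal J (K\<lparr>carrier := R\<rparr>)" "P \<subseteq> J" "J \<subseteq> carrier (K\<lparr>carrier := R\<rparr>)"
  note J_R = ideal_of_subringE[OF J(1)]
  obtain p where p: "p \<in> P" "p \<noteq> \<zero>"
    using P(2) P_R(2) by blast
  show "J = P \<or> J = carrier (K\<lparr>carrier := R\<rparr>)"
  proof (cases "J = P")
    case False
    then obtain j where j: "j \<in> J" "j \<notin> P"
      using J(2) by blast
    have j_R: "j \<in> R" "j \<in> carrier K"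
      using j(1) J_R(1) R_closed by auto
    have "\<one> \<in> J"
    proof (rule one_mem_ideal_of_trivial_colon[OF J(1)])
      show "J \<noteq> {\<zero>}"
        using p J(2) by blast
      fix w assume w: "w \<in> carrier K" "\<And>h. h \<in> J \<Longrightarrow> w \<otimes> h \<in> R"
      show "almost_integral w"
      proof (rule almost_integralI_invariant[OF w(1) p P'(2)])
        fix a assume a: "a \<in> P"
        have wa: "w \<otimes> a \<in> R"
          using w(2) a J(2) by blast
        have "(w \<otimes> a) \<otimes> j = (w \<otimes> j) \<otimes> a"
          using w(1) j_R(2) a P'(2) R_closed by (simp add: m_ac subset_iff)
        then have "(w \<otimes> a) \<otimes> j \<in> P"
          using P_R(4)[OF w(2)[OF j(1)] a] by simp
        then show "w \<otimes> a \<in> P"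
          using P'(4)[OF wa j_R(1)] j(2) by blast
      qed
    qed
    then have "r \<in> J" if "r \<in> R" for r
      using J_R(4)[OF that] R_closed[OF that] by fastforce
    then show ?thesis
      using J_R(1) by auto
  qed simp
qed

end

theorem theorem2p16:
  fixes R :: "'a set" and K :: "('a, 'b) ring_scheme"
  assumes "mori_domain R K" and "sQQR_domain R K"
  shows "dedekind_domain R K"
proof -
  interpret mori_sQQR_domain R K
    using assms by (rule mori_sQQR_domain.intro)
  have "noetherian_ring (K\<lparr>carrier := R\<rparr>)"
  proof (rule ring.noetherian_ringI)
    show "ring (K\<lparr>carrier := R\<rparr>)"
      using R_cring by (rule cring.axioms(1))
    show "\<exists>A\<subseteq>carrier (K\<lparr>carrier := R\<rparr>). finite A \<and> I = Idl\<^bsub>K\<lparr>carrier := R\<rparr>\<^esub> A"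
      if "ideal I (K\<lparr>carrier := R\<rparr>)" for I
    proof -
      obtain A where "A \<subseteq> I" "finite A" "I = Idl\<^bsub>K\<lparr>carrier := R\<rparr>\<^esub> A"
        using ideal_finitely_generated[OF \<open>ideal I _\<close>] by blast
      moreover have "I \<subseteq> carrier (K\<lparr>carrier := R\<rparr>)"
        using ideal_of_subringE(1)[OF \<open>ideal I _\<close>] by simp
      ultimately show ?thesis
        by blast
    qed
  qed
  moreover have "x \<in> R" if "x \<in> carrier K" "integral_over_R x" for x
    using integral_imp_almost_integral[OF that] by (rule almost_integral_mem_R)
  ultimately show ?thesis
    using nonzero_primeideal_maximal domain_in_quotient_field_axioms
    by (intro dedekind_domain.intro dedekind_domain_axioms.intro)
qed

end
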